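(* Let $n\in\{2,3\}$, $k>0$, $d\in\mathbb{S}^{n-1}$ and $\rho\in\{1,2\}$. Let $D\subset\mathbb{R}^n$ be a bounded Lipschitz domain, let $\eta$ be a bounded (complex-valued) function on $\mathbb{R}^n$ with $\eta=0$ in $\mathbb{R}^n\setminus\overline{D}$, and let $\Omega\subset\mathbb{R}^n$ be a bounded Lipschitz domain with $\overline{D}\subset\Omega$ and outward unit normal $\nu$ on $\partial\Omega$. Let $u_{\mathrm{sc}}\in H^1_{\mathrm{loc}}(\mathbb{R}^n)$ be the scattered field of the scattering problem for $\eta$ and incident wave $e^{ikx\cdot d}$, and define, for $z\in\mathbb{R}^n$, $$\mathcal{I}(z)=\left|\int_{\partial\Omega}\left(\frac{\partial\,\mathrm{Im}\,\Phi(x,z)}{\partial\nu(x)}\,u_{\mathrm{sc}}(x)-\mathrm{Im}\,\Phi(x,z)\,\frac{\partial u_{\mathrm{sc}}(x)}{\partial\nu(x)}\right)\mathrm{d}s(x)\right|^{\rho}.$$ Then, for $z\notin D$, $$\mathcal{I}(z)=O\left(\frac{1}{\mathrm{dist}(z,D)^{\rho(n-1)/2}}\right)\quad\text{as }\mathrm{dist}(z,D)\to\infty.$$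
   Context: Scattering problem: $u_{\mathrm{sc}}\in H^1_{\mathrm{loc}}(\mathbb{R}^n)$ is a weak solution of $$\Delta u+k^2(1+\eta(x))u=0 \ \text{ in }\mathbb{R}^n,\qquad u=u_{\mathrm{sc}}+u_{\mathrm{in}},\qquad u_{\mathrm{in}}(x)=e^{ikx\cdot d},$$ satisfying the Sommerfeld radiation condition $\lim_{r\to\infty}r^{(n-1)/2}\left(\frac{\partial u_{\mathrm{sc}}}{\partial r}-iku_{\mathrm{sc}}\right)=0$, $r=|x|$, uniformly in all directions $x/|x|\in\mathbb{S}^{n-1}=\{x\in\mathbb{R}^n:|x|=1\}$. Equivalently (a standard fact), $u_{\mathrm{sc}}$ satisfies the Lippmann-Schwinger equation $u_{\mathrm{sc}}(x)=k^2\int_D\Phi(x,y)\eta(y)u(y)\,\mathrm{d}y$ for $x\in\mathbb{R}^n$. $\Phi$ is the free-space Green's function of the Helmholtz equation: for $x\neq y$, $\Phi(x,y)=\frac{i}{4}H^{(1)}_0(k|x-y|)$ if $n=2$ and $\Phi(x,y)=\frac{e^{ik|x-y|}}{4\pi|x-y|}$ if $n=3$. Its imaginary part $\mathrm{Im}\,\Phi(x,y)$ extends smoothly to $x=y$, and this extension is used throughout. $\mathrm{dist}(z,D)=\inf_{y\in D}|z-y|$. The domains, $\eta$, $k$, $d$, $\rho$ and $u_{\mathrm{sc}}$ are fixed, and the implied constant may depend on them but not on $z$. *)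

theory Defs
  imports "HOL-Analysis.Analysis" "HOL-Library.Landau_Symbols"
begin

section \<open>Bounded Lipschitz domains, outward normal, surface measure\<close>

text \<open>Near every boundary point, \<open>D\<close> is the strict epigraph, in the direction of a unit vector
  \<open>e\<close>, of a Lipschitz function on the hyperplane orthogonal to \<open>e\<close>.\<close>

definition bounded_lipschitz_domain :: "'a::euclidean_space set \<Rightarrow> bool" where
  "bounded_lipschitz_domain D \<longleftrightarrow>
     D \<noteq> {} \<and> open D \<and> connected D \<and> bounded D \<and>
     (\<forall>p\<in>frontier D. \<exists>e r L \<gamma>. norm e = 1 \<and> r > 0 \<and> lipschitz_on L {y. y \<bullet> e = 0} \<gamma> \<and>
        D \<inter> ball p r = {y \<in> ball p r. \<gamma> (y - (y \<bullet> e) *\<^sub>R e) < y \<bullet> e})"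

text \<open>\<open>\<nu>\<close> is the outward unit normal at \<open>x\<close> if, to first order at \<open>x\<close>, the set is the half-space
  \<open>\<nu> \<bullet> (y - x) < 0\<close>. On the boundary of a Lipschitz domain this holds precisely where the local
  graph is differentiable, hence almost everywhere (Rademacher). On the remaining null set
  \<open>outward_normal\<close> has the dummy value \<open>0\<close>.\<close>

definition is_outward_normal :: "'a::euclidean_space set \<Rightarrow> 'a \<Rightarrow> 'a \<Rightarrow> bool" where
  "is_outward_normal \<Omega> x \<nu> \<longleftrightarrow> norm \<nu> = 1 \<and>
     (\<forall>\<epsilon>>0. eventually (\<lambda>y.
        (\<nu> \<bullet> (y - x) < - \<epsilon> * norm (y - x) \<longrightarrow> y \<in> \<Omega>) \<and>
        (\<nu> \<bullet> (y - x) > \<epsilon> * norm (y - x) \<longrightarrow> y \<notin> closure \<Omega>)) (at x))"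

definition outward_normal :: "'a::euclidean_space set \<Rightarrow> 'a \<Rightarrow> 'a" where
  "outward_normal \<Omega> x =
     (if \<exists>!\<nu>. is_outward_normal \<Omega> x \<nu> then THE \<nu>. is_outward_normal \<Omega> x \<nu> else 0)"

lemma is_outward_normal_unique:
  fixes \<nu> \<mu> :: "'a::euclidean_space"
  assumes "is_outward_normal \<Omega> x \<nu>" "is_outward_normal \<Omega> x \<mu>"
  shows "\<nu> = \<mu>"
proof (rule ccontr)
  assume ne: "\<nu> \<noteq> \<mu>"
  have nn: "norm \<nu> = 1" "norm \<mu> = 1"
    using assms by (auto simp: is_outward_normal_def)
  define w where "w = \<nu> - \<mu>"
  define c where "c = \<nu> \<bullet> w / (2 * norm w)"
  have w: "norm w > 0" using ne by (simp add: w_def)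
  have sq: "\<nu> \<bullet> \<nu> = 1" "\<mu> \<bullet> \<mu> = 1" using nn by (simp_all add: dot_square_norm)
  have "0 < w \<bullet> w" using w by simp
  then have pos: "\<nu> \<bullet> w > 0" and neg: "\<mu> \<bullet> w = - (\<nu> \<bullet> w)"
    using sq by (auto simp: w_def algebra_simps inner_commute)
  have c: "c > 0" using pos w by (simp add: c_def)
  have lim: "filterlim (\<lambda>t. x + t *\<^sub>R w) (at x) (at_right (0::real))"
    unfolding filterlim_at
  proof
    show "eventually (\<lambda>t. x + t *\<^sub>R w \<in> UNIV \<and> x + t *\<^sub>R w \<noteq> x) (at_right (0::real))"
      using w by (auto simp: eventually_at_right_field intro!: exI[of _ 1])
    show "((\<lambda>t. x + t *\<^sub>R w) \<longlongrightarrow> x) (at_right 0)"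
      by (auto intro!: tendsto_eq_intros)
  qed
  have "eventually (\<lambda>y. y \<notin> closure \<Omega> \<or> \<not> \<nu> \<bullet> (y - x) > c * norm (y - x)) (at x)"
    using assms(1) c unfolding is_outward_normal_def by (auto elim!: allE[of _ c] eventually_mono)
  moreover have "eventually (\<lambda>y. y \<in> \<Omega> \<or> \<not> \<mu> \<bullet> (y - x) < - c * norm (y - x)) (at x)"
    using assms(2) c unfolding is_outward_normal_def by (auto elim!: allE[of _ c] eventually_mono)
  ultimately have "eventually (\<lambda>y. \<not> (\<nu> \<bullet> (y - x) > c * norm (y - x) \<and>
      \<mu> \<bullet> (y - x) < - c * norm (y - x))) (at x)"
    by eventually_elim (use closure_subset in blast)
  then have "eventually (\<lambda>t. \<not> (\<nu> \<bullet> (t *\<^sub>R w) > c * norm (t *\<^sub>R w) \<and>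
      \<mu> \<bullet> (t *\<^sub>R w) < - c * norm (t *\<^sub>R w))) (at_right (0::real))"
    using lim by (auto simp: filterlim_iff)
  moreover have "eventually (\<lambda>t::real. t > 0) (at_right 0)"
    by (simp add: eventually_at_right_less)
  ultimately have "eventually (\<lambda>t::real. False) (at_right 0)"
  proof eventually_elim
    case (elim t)
    have "c * norm (t *\<^sub>R w) = t * (\<nu> \<bullet> w) / 2"
      using elim(2) w by (simp add: c_def field_simps)
    then show False using elim pos neg by (simp add: field_simps)
  qed
  then show False by simp
qed

text \<open>The Hausdorff measure of dimension \<open>s > 0\<close>, normalised to agree with Lebesgue measure for
  integer \<open>s\<close>. It is a metric outer measure, hence countably additive on the Borel sets.\<close>

definition hausdorff_pre :: "real \<Rightarrow> real \<Rightarrow> 'a::metric_space set \<Rightarrow> ennreal" where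
  "hausdorff_pre s \<delta> A =
     (INF U \<in> {U :: nat \<Rightarrow> 'a set. A \<subseteq> (\<Union>i. U i) \<and> (\<forall>i. bounded (U i) \<and> diameter (U i) \<le> \<delta>)}.
        \<Sum>i. ennreal (unit_ball_vol s * (diameter (U i) / 2) powr s))"

definition hausdorff_outer :: "real \<Rightarrow> 'a::metric_space set \<Rightarrow> ennreal" where
  "hausdorff_outer s A = (SUP \<delta> \<in> {0<..}. hausdorff_pre s \<delta> A)"

definition surface_measure :: "(real ^ 'n) measure" where
  "surface_measure = measure_of UNIV (sets borel) (hausdorff_outer (real CARD('n) - 1))"


section \<open>The Green's function of the Helmholtz equation\<close>

definition bessel_J0 :: "real \<Rightarrow> real" where
  "bessel_J0 x = (\<Sum>m. (- 1) ^ m * (x\<^sup>2 / 4) ^ m / (fact m)\<^sup>2)"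

definition bessel_Y0 :: "real \<Rightarrow> real" where
  "bessel_Y0 x = 2 / pi * (ln (x / 2) + euler_mascheroni) * bessel_J0 x
     + 2 / pi * (\<Sum>m. (- 1) ^ (m + 1) * harm m * (x\<^sup>2 / 4) ^ m / (fact m)\<^sup>2)"

definition hankel_H10 :: "real \<Rightarrow> complex" where
  "hankel_H10 x = Complex (bessel_J0 x) (bessel_Y0 x)"

text \<open>Only meant for dimensions two and three and for \<open>x \<noteq> y\<close>.\<close>

definition green :: "real \<Rightarrow> real ^ 'n \<Rightarrow> real ^ 'n \<Rightarrow> complex" where
  "green k x y =
     (if CARD('n) = 2 then \<i> / 4 * hankel_H10 (k * dist x y)
      else exp (\<i> * of_real (k * dist x y)) / of_real (4 * pi * dist x y))"

definition im_green :: "real \<Rightarrow> real ^ 'n \<Rightarrow> real ^ 'n \<Rightarrow> real" where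
  "im_green k x y =
     (if x = y then Lim (at y) (\<lambda>x'. Im (green k x' y)) else Im (green k x y))"


section \<open>Weak derivatives and local Sobolev functions\<close>

definition partial_deriv :: "'n \<Rightarrow> (real ^ 'n \<Rightarrow> real) \<Rightarrow> real ^ 'n \<Rightarrow> real" where
  "partial_deriv i \<phi> x = frechet_derivative \<phi> (at x) (axis i 1)"

definition test_function :: "(real ^ 'n \<Rightarrow> real) \<Rightarrow> bool" where
  "test_function \<phi> \<longleftrightarrow>
     (\<forall>is x. foldr partial_deriv is \<phi> differentiable (at x)) \<and> compact (closure {x. \<phi> x \<noteq> 0})"

definition L2_loc :: "(real ^ 'n \<Rightarrow> 'b::euclidean_space) \<Rightarrow> bool" where
  "L2_loc f \<longleftrightarrow> f \<in> borel_measurable lebesgue \<and>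
     (\<forall>K. compact K \<longrightarrow> set_integrable lebesgue K (\<lambda>x. (norm (f x))\<^sup>2))"

definition weak_gradient :: "(real ^ 'n \<Rightarrow> complex) \<Rightarrow> (real ^ 'n \<Rightarrow> complex ^ 'n) \<Rightarrow> bool" where
  "weak_gradient u g \<longleftrightarrow> (\<forall>\<phi> i. test_function \<phi> \<longrightarrow>
     (LINT x|lebesgue. partial_deriv i \<phi> x *\<^sub>R u x) = - (LINT x|lebesgue. \<phi> x *\<^sub>R (g x $ i)))"

definition H1_loc :: "(real ^ 'n \<Rightarrow> complex) \<Rightarrow> bool" where
  "H1_loc u \<longleftrightarrow> L2_loc u \<and> (\<exists>g. L2_loc g \<and> weak_gradient u g)"


section \<open>The scattering problem\<close>

text \<open>Real test functions suffice in the weak formulation, by linearity.\<close>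

definition weak_helmholtz_solution ::
    "real \<Rightarrow> (real ^ 'n \<Rightarrow> complex) \<Rightarrow> (real ^ 'n \<Rightarrow> complex) \<Rightarrow> bool" where
  "weak_helmholtz_solution k \<eta> u \<longleftrightarrow> L2_loc u \<and>
     (\<exists>g. L2_loc g \<and> weak_gradient u g \<and>
        (\<forall>\<phi>. test_function \<phi> \<longrightarrow>
           (LINT x|lebesgue. (\<Sum>i\<in>UNIV. partial_deriv i \<phi> x *\<^sub>R (g x $ i)))
             = (LINT x|lebesgue. \<phi> x *\<^sub>R (of_real (k\<^sup>2) * (1 + \<eta> x) * u x))))"

definition incident_field :: "real \<Rightarrow> real ^ 'n \<Rightarrow> real ^ 'n \<Rightarrow> complex" where
  "incident_field k d x = exp (\<i> * of_real (k * (x \<bullet> d)))"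

definition sommerfeld :: "real \<Rightarrow> (real ^ 'n \<Rightarrow> complex) \<Rightarrow> bool" where
  "sommerfeld k u \<longleftrightarrow>
     uniform_limit (sphere 0 1)
       (\<lambda>r \<theta>. r powr ((real CARD('n) - 1) / 2) *\<^sub>R
          (vector_derivative (\<lambda>t. u (t *\<^sub>R \<theta>)) (at r) - \<i> * of_real k * u (r *\<^sub>R \<theta>)))
       (\<lambda>\<theta>. 0) at_top"

text \<open>An element of the local Sobolev space is a class of functions modulo null sets, whereas the
  radiation condition and boundary integrals use pointwise values. The last conjunct selects the
  representative: off \<open>closure D\<close> the scattered field is a weak solution of the Helmholtz equation
  with constant coefficients, so by elliptic regularity (Weyl's lemma) it agrees almost everywhere
  there with a unique continuous, in fact real-analytic, function, and this is the function that
  is meant by the classical expressions.\<close>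

definition scattered_field ::
    "real \<Rightarrow> real ^ 'n \<Rightarrow> (real ^ 'n) set \<Rightarrow> (real ^ 'n \<Rightarrow> complex) \<Rightarrow> (real ^ 'n \<Rightarrow> complex) \<Rightarrow> bool"
  where
  "scattered_field k d D \<eta> u\<^sub>s\<^sub>c \<longleftrightarrow>
     H1_loc u\<^sub>s\<^sub>c \<and>
     weak_helmholtz_solution k \<eta> (\<lambda>x. u\<^sub>s\<^sub>c x + incident_field k d x) \<and>
     sommerfeld k u\<^sub>s\<^sub>c \<and>
     continuous_on (- closure D) u\<^sub>s\<^sub>c"


section \<open>The indicator functional\<close>

definition indicator_functional ::
    "nat \<Rightarrow> real \<Rightarrow> (real ^ 'n) set \<Rightarrow> (real ^ 'n \<Rightarrow> complex) \<Rightarrow> real ^ 'n \<Rightarrow> real" where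
  "indicator_functional \<rho> k \<Omega> u z =
     (norm (LINT x:frontier \<Omega>|surface_measure.
        of_real (frechet_derivative (\<lambda>y. im_green k y z) (at x) (outward_normal \<Omega> x)) * u x
        - of_real (im_green k x z) * frechet_derivative u (at x) (outward_normal \<Omega> x))) ^ \<rho>"

end

theory Submission
  imports Defs "HOL-Computational_Algebra.Polynomial" "HOL-Real_Asymp.Real_Asymp"
begin

text \<open>The integrand is estimated pointwise. The imaginary part of the Green's function and its gradient
  are of order \<open>r powr (- (n - 1) / 2)\<close> at distance \<open>r\<close>, where for \<open>n = 2\<close> this is the decay of the
  Bessel function \<open>J0\<close> and its derivative. Hence it suffices that the boundary of \<open>\<Omega>\<close> has finite
  surface measure and that the scattered field and its gradient are bounded on it.

  The latter is an instance of Weyl's lemma. Let \<open>u\<close> be a continuous distributional solution of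
  \<open>\<Delta>u = \<kappa>u\<close> and \<open>K\<^sub>\<epsilon>(w) = \<epsilon> powr (- n) * q(|w|\<^sup>2/\<epsilon>\<^sup>2)\<close> a smooth radial mollifier. With
  \<open>\<psi>\<^sub>\<epsilon>(w) = (h \<bullet> w) q(|w|\<^sup>2/\<epsilon>\<^sup>2)\<close>, the \<open>\<epsilon>\<close>-derivative of the derivative of \<open>u * K\<^sub>\<epsilon>\<close> in direction \<open>h\<close> is
  \<open>\<epsilon> powr (- n - 1) \<integral>u \<Delta>\<psi>\<^sub>\<epsilon> = \<epsilon> powr (- n - 1) \<kappa> \<integral>u \<psi>\<^sub>\<epsilon>\<close>, which is bounded uniformly in \<open>\<epsilon>\<close>. So the gradients
  of \<open>u * K\<^sub>\<epsilon>\<close> converge locally uniformly as \<open>\<epsilon>\<close> tends to \<open>0\<close>.\<close>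

section \<open>Decay of the Green's function\<close>

text \<open>The boundary of \<open>\<Omega>\<close> is a Lebesgue null set, so almost-everywhere
  regularity says nothing there, and \<open>frechet_derivative\<close> is an unspecified choice
  where no derivative exists. Hence the scattered field is shown to be differentiable at every
  boundary point. The identity behind Weyl's lemma arises as follows. Put s = |w|^2 /
  \<open>\<epsilon>\<close>^2 and let Q' = q. The derivative of the mollifier in
  \<open>\<epsilon>\<close> is - \<open>\<epsilon>\<close>^(-n-1) div(w q(s)), and w q(s) is the
  gradient of (\<open>\<epsilon>\<close>^2 / 2) Q(s). So it is a multiple of the Laplacian of a
  radial function. One further derivative in direction h turns Q into q, which is how (h . w) q(s)
  appears. Treating the gradient of the mollification instead of the mollification itself thus keeps
  the antiderivative Q out of the construction. The bound is uniform by scaling: (h . w) q(s) has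
  size at most |h| \<open>\<epsilon>\<close> on a ball whose volume is of order
  \<open>\<epsilon>\<close>^n, which balances the prefactor \<open>\<epsilon>\<close>^(-n-1)
  exactly.\<close>

definition bessel_J0_coeff :: "nat \<Rightarrow> real" where
  "bessel_J0_coeff m = (- 1) ^ m / (fact m)\<^sup>2"

lemma summable_bessel_J0_coeff: "summable (\<lambda>m. bessel_J0_coeff m * x ^ m)"
proof (rule summable_comparison_test')
  show "summable (\<lambda>m. \<bar>x\<bar> ^ m / fact m)"
    using summable_exp[of "\<bar>x\<bar>"] by (simp add: field_simps)
  show "norm (bessel_J0_coeff m * x ^ m) \<le> \<bar>x\<bar> ^ m / fact m" if "m \<ge> 0" for m
  proof -
    have "(fact m :: real) \<le> (fact m)\<^sup>2"
      by (simp add: power2_eq_square)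
    then have "\<bar>x\<bar> ^ m / (fact m)\<^sup>2 \<le> \<bar>x\<bar> ^ m / fact m"
      by (intro divide_left_mono) auto
    then show ?thesis
      by (simp add: bessel_J0_coeff_def abs_mult power_abs)
  qed
qed

text \<open>\<open>J0\<close> in the variable s = x^2 / 4, where it is an ordinary power series that
  converges everywhere and can be differentiated termwise.\<close>

definition bessel_series :: "real \<Rightarrow> real" where
  "bessel_series s = (\<Sum>m. bessel_J0_coeff m * s ^ m)"

definition bessel_series' :: "real \<Rightarrow> real" where
  "bessel_series' s = (\<Sum>m. diffs bessel_J0_coeff m * s ^ m)"

definition bessel_series'' :: "real \<Rightarrow> real" where
  "bessel_series'' s = (\<Sum>m. diffs (diffs bessel_J0_coeff) m * s ^ m)"

lemma DERIV_bessel_series: "(bessel_series has_real_derivative bessel_series' s) (at s)"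
  unfolding bessel_series_def[abs_def] bessel_series'_def
  by (rule termdiffs_strong_converges_everywhere) (rule summable_bessel_J0_coeff)

lemma DERIV_bessel_series': "(bessel_series' has_real_derivative bessel_series'' s) (at s)"
  unfolding bessel_series''_def bessel_series'_def[abs_def]
  by (rule termdiffs_strong_converges_everywhere)
     (rule termdiff_converges_all, rule summable_bessel_J0_coeff)

text \<open>This is Bessel's equation of order zero after the substitution s = x^2 / 4. On
  coefficients it is the recurrence (m+1)^2 c(m+1) = - c(m), where \<open>diffs\<close> already
  supplies one factor m+1.\<close>

lemma bessel_series_ode:
  "s * bessel_series'' s + bessel_series' s + bessel_series s = 0"
proof -
  let ?c = bessel_J0_coeff
  have s1: "summable (\<lambda>m. diffs ?c m * s ^ m)" for s
    by (rule termdiff_converges_all, rule summable_bessel_J0_coeff)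
  have s2: "summable (\<lambda>m. diffs (diffs ?c) m * s ^ m)" for s
    by (rule termdiff_converges_all, rule s1)
  have "(\<lambda>m. diffs (diffs ?c) m * s ^ m) sums bessel_series'' s"
    unfolding bessel_series''_def using s2 by (rule summable_sums)
  then have "(\<lambda>m. s * (diffs (diffs ?c) m * s ^ m)) sums (s * bessel_series'' s)"
    by (rule sums_mult)
  \<comment> \<open>Multiplying by s shifts the index by one; the new term at m = 0 is zero because
    of the factor \<open>real m\<close>.\<close>
  then have "(\<lambda>m. real m * diffs ?c m * s ^ m) sums (s * bessel_series'' s)"
    by (subst sums_Suc_iff[symmetric, where f = "\<lambda>m. real m * diffs ?c m * s ^ m", simplified])
       (simp_all add: diffs_def mult_ac)
  moreover have "(\<lambda>m. diffs ?c m * s ^ m) sums bessel_series' s"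
    unfolding bessel_series'_def using s1 by (rule summable_sums)
  moreover have "(\<lambda>m. ?c m * s ^ m) sums bessel_series s"
    unfolding bessel_series_def using summable_bessel_J0_coeff by (rule summable_sums)
  ultimately have "(\<lambda>m. real m * diffs ?c m * s ^ m + diffs ?c m * s ^ m + ?c m * s ^ m) sums
      (s * bessel_series'' s + bessel_series' s + bessel_series s)"
    by (intro sums_add)
  moreover have "real m * diffs ?c m * s ^ m + diffs ?c m * s ^ m + ?c m * s ^ m = 0" for m
  proof -
    have "(real m + 1) * diffs ?c m = - ?c m"
    proof -
      have "(fact (Suc m))\<^sup>2 = (real m + 1)\<^sup>2 * (fact m :: real)\<^sup>2"
        by (simp add: power_mult_distrib add.commute)
      then show ?thesis
        by (simp add: diffs_def bessel_J0_coeff_def power2_eq_square add.commute del: fact_Suc)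
    qed
    then have "((real m + 1) * diffs ?c m + ?c m) * s ^ m = 0" by simp
    then show ?thesis by (simp only: algebra_simps)
  qed
  ultimately show ?thesis using sums_unique2[OF _ sums_zero] by simp
qed

definition bessel_J0' :: "real \<Rightarrow> real" where
  "bessel_J0' x = x / 2 * bessel_series' (x\<^sup>2 / 4)"

lemma bessel_J0_eq_series: "bessel_J0 x = bessel_series (x\<^sup>2 / 4)"
  by (simp add: bessel_J0_def bessel_series_def bessel_J0_coeff_def)

lemma DERIV_bessel_J0: "(bessel_J0 has_real_derivative bessel_J0' x) (at x)"
  unfolding bessel_J0_eq_series[abs_def] bessel_J0'_def
  by (rule DERIV_chain2[OF DERIV_bessel_series, THEN DERIV_cong])
     (rule derivative_eq_intros refl | simp)+

lemma DERIV_bessel_J0':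
  assumes "x > 0"
  shows "(bessel_J0' has_real_derivative - bessel_J0' x / x - bessel_J0 x) (at x)"
proof -
  have "(bessel_J0' has_real_derivative
      1 / 2 * bessel_series' (x\<^sup>2 / 4) + x / 2 * (bessel_series'' (x\<^sup>2 / 4) * (x / 2))) (at x)"
    unfolding bessel_J0'_def[abs_def]
    by (rule derivative_eq_intros DERIV_chain2[OF DERIV_bessel_series'] refl | simp)+
  moreover have "1 / 2 * bessel_series' (x\<^sup>2 / 4) + x / 2 * (bessel_series'' (x\<^sup>2 / 4) * (x / 2))
      = - bessel_J0' x / x - bessel_J0 x"
    using bessel_series_ode[of "x\<^sup>2 / 4"] assms
    by (simp add: bessel_J0'_def bessel_J0_eq_series field_simps power2_eq_square)
  ultimately show ?thesis by simp
qed

text \<open>The function \<open>v = sqrt x * J0 x\<close> solves \<open>v'' + (1 + 1/(4x\<^sup>2)) v = 0\<close>, so the energy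
  \<open>v'\<^sup>2 + (1 + 1/(4x\<^sup>2)) v\<^sup>2\<close> is decreasing. It is written out here in terms of \<open>J0\<close>.\<close>

lemma bessel_J0_decay:
  "\<exists>C\<ge>0. \<forall>x\<ge>1. \<bar>bessel_J0 x\<bar> \<le> C * x powr (- 1 / 2) \<and> \<bar>bessel_J0' x\<bar> \<le> C * x powr (- 1 / 2)"
proof -
  define E where "E = (\<lambda>x. x * (bessel_J0' x)\<^sup>2 + bessel_J0 x * bessel_J0' x
    + (bessel_J0 x)\<^sup>2 / (2 * x) + x * (bessel_J0 x)\<^sup>2)"
  have dE: "(E has_real_derivative - (bessel_J0 x)\<^sup>2 / (2 * x\<^sup>2)) (at x)" if "x > 0" for x
    unfolding E_def using that
    by (auto intro!: derivative_eq_intros DERIV_bessel_J0 DERIV_bessel_J0'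
        simp: field_simps power2_eq_square)
  have E_le: "E x \<le> E 1" if "x \<ge> 1" for x
  proof (rule DERIV_nonpos_imp_nonincreasing[of 1 x E])
    show "1 \<le> x" by fact
    fix y :: real assume "1 \<le> y" "y \<le> x"
    then have "(E has_real_derivative - (bessel_J0 y)\<^sup>2 / (2 * y\<^sup>2)) (at y)"
      by (intro dE) auto
    then show "\<exists>z. (E has_real_derivative z) (at y) \<and> z \<le> 0"
      by (intro exI[of _ "- (bessel_J0 y)\<^sup>2 / (2 * y\<^sup>2)"]) simp
  qed
  \<comment> \<open>The square root of the bound \<open>4 * E 1\<close> in \<open>bds\<close>: on
    [1, infinity) the decreasing energy is largest at 1.\<close>
  define C where "C = 2 * sqrt (E 1)"
  have main: "\<bar>a\<bar> \<le> C * x powr (- 1 / 2)" if "x \<ge> 1" "x * a\<^sup>2 \<le> 4 * E 1" for a x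
  proof -
    have "x * a\<^sup>2 = (sqrt x * \<bar>a\<bar>)\<^sup>2" using that by (simp add: power_mult_distrib)
    then have "sqrt x * \<bar>a\<bar> \<le> sqrt (4 * E 1)"
      using that(2) by (intro real_le_rsqrt) simp
    then have "sqrt x * \<bar>a\<bar> \<le> C" by (simp add: C_def real_sqrt_mult)
    then have "\<bar>a\<bar> \<le> C / sqrt x" using that by (simp add: field_simps)
    also have "C / sqrt x = C * x powr (- 1 / 2)"
      using that by (simp add: powr_minus_divide powr_half_sqrt)
    finally show ?thesis .
  qed
  have bds: "x * (bessel_J0 x)\<^sup>2 \<le> 4 * E 1" "x * (bessel_J0' x)\<^sup>2 \<le> 4 * E 1" if "x \<ge> 1" for x
  proof -
    define j j' where "j = bessel_J0 x" and "j' = bessel_J0' x"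
    have e: "x * j'\<^sup>2 + j * j' + j\<^sup>2 / (2 * x) + x * j\<^sup>2 \<le> E 1"
      using E_le[OF that] unfolding E_def j_def j'_def .
    have sq: "(2 * x * j' + j)\<^sup>2 / (4 * x) = x * j'\<^sup>2 + j * j' + j\<^sup>2 / (4 * x)"
      "(x * j' + j)\<^sup>2 / x = x * j'\<^sup>2 + 2 * (j * j') + j\<^sup>2 / x"
      using that by (auto simp: field_simps power2_eq_square)
    have nn: "(2 * x * j' + j)\<^sup>2 / (4 * x) \<ge> 0" "(x * j' + j)\<^sup>2 / x \<ge> 0" "j\<^sup>2 / x \<ge> 0"
      "x * j\<^sup>2 \<ge> 0" "x * j'\<^sup>2 \<ge> 0"
      using that by auto
    \<comment> \<open>Read A = x j'^2, B = j j', H = j^2 / x, D = x j^2. The first square alone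
      gives D \<le> e; half of the second gives A / 2 + D \<le> e. The common factor 4 is slack,
      chosen as a perfect square.\<close>
    have lin: "D \<le> 4 * e \<and> A \<le> 4 * e"
      if "A + B + H / 2 + D \<le> e" "0 \<le> A + B + H / 4" "0 \<le> A + 2 * B + H" "0 \<le> H" "0 \<le> D" "0 \<le> A"
      for A B D H e :: real
      using that by linarith
    have r: "j\<^sup>2 / (2 * x) = j\<^sup>2 / x / 2" "j\<^sup>2 / (4 * x) = j\<^sup>2 / x / 4"
      by auto
    show "x * (bessel_J0 x)\<^sup>2 \<le> 4 * E 1" "x * (bessel_J0' x)\<^sup>2 \<le> 4 * E 1"
      using e nn unfolding sq r j_def[symmetric] j'_def[symmetric]
      by (blast dest: lin)+
  qed
  have "E 1 \<ge> 0" using bds(1)[of 1] by (smt (verit) zero_le_power2 mult_1)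
  then have "C \<ge> 0" by (simp add: C_def)
  then show ?thesis using bds main by (intro exI[of _ C]) auto
qed

section \<open>Decay of the imaginary part of the Green's function as a radial function\<close>

lemma radial_has_derivative:
  fixes x z :: "'a::real_inner"
  assumes "x \<noteq> z" "(F has_real_derivative F') (at (dist x z))" and f: "\<And>y. y \<noteq> z \<Longrightarrow> f y = F (dist y z)"
  shows "(f has_derivative (\<lambda>h. F' * (sgn (x - z) \<bullet> h))) (at x)"
proof -
  have "((\<lambda>y. dist y z) has_derivative (\<lambda>h. sgn (x - z) \<bullet> h)) (at x)"
  proof -
    have "((\<lambda>y. y - z) has_derivative (\<lambda>h. h)) (at x)"
      by (auto intro!: derivative_eq_intros)
    from has_derivative_compose[OF this has_derivative_norm] show ?thesis
      using \<open>x \<noteq> z\<close> by (simp add: dist_norm inner_commute)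
  qed
  then have "((\<lambda>y. F (dist y z)) has_derivative (\<lambda>h. (sgn (x - z) \<bullet> h) * F')) (at x)"
    by (rule DERIV_compose_FDERIV[where g = "\<lambda>y. dist y z", OF assms(2)])
  then have "(f has_derivative (\<lambda>h. (sgn (x - z) \<bullet> h) * F')) (at x)"
    by (rule has_derivative_transform_within_open[where s = "- {z}"]) (use assms in auto)
  then show ?thesis by (simp add: mult.commute)
qed

text \<open>The gradient of F(|y - z|) is F' times a unit vector, so bounds on two functions of one
  real variable suffice. Since x and z stay at least \<open>r0\<close> apart, the limit that defines
  \<open>im_green\<close> on the diagonal is never met.\<close>

lemma im_green_decay_of_radial:
  fixes k :: real
  assumes im: "\<And>x z :: real ^ 'n. x \<noteq> z \<Longrightarrow> im_green k x z = F (dist x z)"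
    and F: "\<And>r. 0 < r \<Longrightarrow> (F has_real_derivative F' r) (at r)" and "0 < r0"
    and bd: "\<And>r. r0 \<le> r \<Longrightarrow> \<bar>F r\<bar> \<le> C * r powr a \<and> \<bar>F' r\<bar> \<le> C * r powr a"
    and dist: "r0 \<le> dist x z"
  shows "\<bar>im_green k x (z :: real ^ 'n)\<bar> \<le> C * dist x z powr a"
    "\<bar>frechet_derivative (\<lambda>y. im_green k y z) (at x) h\<bar> \<le> C * dist x z powr a * norm h"
proof -
  have "x \<noteq> z" using \<open>0 < r0\<close> dist by auto
  then show "\<bar>im_green k x z\<bar> \<le> C * dist x z powr a" using im bd[OF dist] by simp
  have "((\<lambda>y. im_green k y z) has_derivative (\<lambda>h. F' (dist x z) * (sgn (x - z) \<bullet> h))) (at x)"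
    using \<open>x \<noteq> z\<close> by (intro radial_has_derivative[where F = F] F im) auto
  then have "frechet_derivative (\<lambda>y. im_green k y z) (at x) h = F' (dist x z) * (sgn (x - z) \<bullet> h)"
    using frechet_derivative_at by metis
  moreover have "\<bar>sgn (x - z) \<bullet> h\<bar> \<le> norm h"
    using Cauchy_Schwarz_ineq2[of "sgn (x - z)" h] \<open>x \<noteq> z\<close> by (simp add: norm_sgn)
  then have "\<bar>F' (dist x z)\<bar> * \<bar>sgn (x - z) \<bullet> h\<bar> \<le> C * dist x z powr a * norm h"
    using bd[OF dist] by (intro mult_mono) (auto intro: order_trans[OF abs_ge_zero])
  ultimately show "\<bar>frechet_derivative (\<lambda>y. im_green k y z) (at x) h\<bar> \<le> C * dist x z powr a * norm h"
    by (simp add: abs_mult)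
qed

lemma im_green_decay:
  fixes k :: real
  assumes n: "CARD('n) \<in> {2, 3}" and "k > 0"
  shows "\<exists>C\<ge>0. \<exists>r0>0. \<forall>x z :: real ^ 'n. r0 \<le> dist x z \<longrightarrow>
    \<bar>im_green k x z\<bar> \<le> C * dist x z powr (- (real CARD('n) - 1) / 2) \<and>
    (\<forall>h. \<bar>frechet_derivative (\<lambda>y. im_green k y z) (at x) h\<bar>
      \<le> C * dist x z powr (- (real CARD('n) - 1) / 2) * norm h)"
proof (cases "CARD('n) = 2")
  case True
  obtain C where "C \<ge> 0" and C: "\<And>x. x \<ge> 1 \<Longrightarrow> \<bar>bessel_J0 x\<bar> \<le> C * x powr (- 1 / 2)"
    "\<And>x. x \<ge> 1 \<Longrightarrow> \<bar>bessel_J0' x\<bar> \<le> C * x powr (- 1 / 2)"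
    using bessel_J0_decay by blast
  \<comment> \<open>The power of k comes from rescaling the argument k r, and the summand k in 1 + k
    from the chain rule. The threshold 1 / k is where k r reaches 1.\<close>
  define C' where "C' = (1 + k) * C * k powr (- 1 / 2)"
  have "C' \<ge> 0" using \<open>C \<ge> 0\<close> \<open>k > 0\<close> by (simp add: C'_def)
  have "\<bar>im_green k x z\<bar> \<le> C' * dist x z powr (- 1 / 2)"
    "\<bar>frechet_derivative (\<lambda>y. im_green k y z) (at x) h\<bar> \<le> C' * dist x z powr (- 1 / 2) * norm h"
    if "1 / k \<le> dist x z" for x z h :: "real ^ 'n"
  proof -
    have im: "im_green k x z = bessel_J0 (k * dist x z) / 4" if "x \<noteq> z" for x z :: "real ^ 'n"
      using that True by (simp add: im_green_def green_def hankel_H10_def)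
    have F: "((\<lambda>r. bessel_J0 (k * r) / 4) has_real_derivative k * bessel_J0' (k * r) / 4) (at r)" for r
      by (auto intro!: derivative_eq_intros DERIV_chain2[OF DERIV_bessel_J0])
    have bd: "\<bar>bessel_J0 (k * r) / 4\<bar> \<le> C' * r powr (- 1 / 2) \<and> \<bar>k * bessel_J0' (k * r) / 4\<bar> \<le> C' * r powr (- 1 / 2)"
      if "1 / k \<le> r" for r
    proof -
      have kr: "k * r \<ge> 1" using that \<open>k > 0\<close> by (simp add: field_simps)
      have "(k * r) powr (- 1 / 2) = k powr (- 1 / 2) * r powr (- 1 / 2)"
        by (rule powr_mult)
      define T where "T = C * (k powr (- 1 / 2) * r powr (- 1 / 2))"
      have J: "\<bar>bessel_J0 (k * r)\<bar> \<le> T" "\<bar>bessel_J0' (k * r)\<bar> \<le> T"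
        using C[OF kr] \<open>_ = k powr (- 1 / 2) * r powr (- 1 / 2)\<close> by (simp_all add: T_def)
      have "T \<ge> 0" using \<open>C \<ge> 0\<close> by (simp add: T_def)
      have eq: "C' * r powr (- 1 / 2) = T + k * T" by (simp add: C'_def T_def algebra_simps)
      have "k * \<bar>bessel_J0' (k * r)\<bar> \<le> k * T" using J \<open>k > 0\<close> by simp
      moreover have "0 \<le> k * T" using \<open>k > 0\<close> \<open>T \<ge> 0\<close> by simp
      moreover have "\<bar>k * bessel_J0' (k * r) / 4\<bar> = k * \<bar>bessel_J0' (k * r)\<bar> / 4"
        using \<open>k > 0\<close> by (simp add: abs_mult)
      ultimately show ?thesis
        unfolding eq using J \<open>T \<ge> 0\<close> by linarith
    qed
    have "0 < 1 / k" using \<open>k > 0\<close> by simp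
    show "\<bar>im_green k x z\<bar> \<le> C' * dist x z powr (- 1 / 2)"
      by (rule im_green_decay_of_radial(1)[OF im F \<open>0 < 1 / k\<close> bd that])
    show "\<bar>frechet_derivative (\<lambda>y. im_green k y z) (at x) h\<bar> \<le> C' * dist x z powr (- 1 / 2) * norm h"
      by (rule im_green_decay_of_radial(2)[OF im F \<open>0 < 1 / k\<close> bd that])
  qed
  moreover have "- (real CARD('n) - 1) / 2 = - 1 / 2" using True by simp
  ultimately show ?thesis
    using \<open>C' \<ge> 0\<close> \<open>k > 0\<close> by (intro exI[of _ C'] conjI exI[of _ "1 / k"]) (auto simp del: minus_divide_left)
next
  case False
  then have n3: "CARD('n) = 3" using n by simp
  \<comment> \<open>In dimension three the exponent -(n - 1) / 2 is -1. The part of the derivative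
    that decays like r^(-2) is absorbed by r^(-1) because r \<ge> 1, and 1 / (4 pi) is estimated by
    1.\<close>
  have "\<bar>im_green k x z\<bar> \<le> (1 + k) * dist x z powr (- 1)"
    "\<bar>frechet_derivative (\<lambda>y. im_green k y z) (at x) h\<bar> \<le> (1 + k) * dist x z powr (- 1) * norm h"
    if "1 \<le> dist x z" for x z h :: "real ^ 'n"
  proof -
    have im: "im_green k x z = sin (k * dist x z) / (4 * pi * dist x z)" if "x \<noteq> z" for x z :: "real ^ 'n"
    proof -
      have "im_green k x z = Im (exp (\<i> * of_real (k * dist x z)) / of_real (4 * pi * dist x z))"
        using that n3 by (simp add: im_green_def green_def)
      also have "\<dots> = sin (k * dist x z) / (4 * pi * dist x z)"
        by (simp only: Im_divide_of_real) (simp add: Im_exp)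
      finally show ?thesis .
    qed
    have F: "((\<lambda>r. sin (k * r) / (4 * pi * r)) has_real_derivative
        (k * cos (k * r) * r - sin (k * r)) / (4 * pi * r * r)) (at r)" if "0 < r" for r
      using that by (auto intro!: derivative_eq_intros simp: field_simps)
    have bd: "\<bar>sin (k * r) / (4 * pi * r)\<bar> \<le> (1 + k) * r powr (- 1) \<and>
        \<bar>(k * cos (k * r) * r - sin (k * r)) / (4 * pi * r * r)\<bar> \<le> (1 + k) * r powr (- 1)"
      if "1 \<le> r" for r
    proof -
      have p: "4 * pi \<ge> 1" using pi_ge_two by simp
      have r: "r powr (- 1) = 1 / r" using that by (simp add: powr_minus_divide)
      have "\<bar>sin (k * r)\<bar> \<le> 1 + k" using abs_sin_le_one[of "k * r"] \<open>k > 0\<close> by linarith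
      then have "\<bar>sin (k * r)\<bar> / (4 * pi * r) \<le> (1 + k) / (1 * r)"
        using p that \<open>k > 0\<close> by (intro frac_le mult_right_mono) auto
      moreover have "\<bar>k * cos (k * r) * r - sin (k * r)\<bar> \<le> (1 + k) * r"
      proof -
        have "\<bar>k * cos (k * r) * r\<bar> \<le> k * 1 * r"
          using abs_cos_le_one[of "k * r"] \<open>k > 0\<close> that
          unfolding abs_mult by (intro mult_mono) auto
        moreover have "(1 + k) * r = r + k * 1 * r" by (simp add: algebra_simps)
        ultimately show ?thesis using abs_sin_le_one[of "k * r"] that by linarith
      qed
      then have "\<bar>k * cos (k * r) * r - sin (k * r)\<bar> / (4 * pi * r * r) \<le> ((1 + k) * r) / (1 * r * r)"
        using p that \<open>k > 0\<close> by (intro frac_le mult_right_mono) auto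
      ultimately show ?thesis using that by (simp add: r abs_divide abs_mult)
    qed
    show "\<bar>im_green k x z\<bar> \<le> (1 + k) * dist x z powr (- 1)"
      by (rule im_green_decay_of_radial(1)[OF im F zero_less_one bd that])
    show "\<bar>frechet_derivative (\<lambda>y. im_green k y z) (at x) h\<bar> \<le> (1 + k) * dist x z powr (- 1) * norm h"
      by (rule im_green_decay_of_radial(2)[OF im F zero_less_one bd that])
  qed
  moreover have "- (real CARD('n) - 1) / 2 = - 1" using n3 by simp
  ultimately show ?thesis
    using \<open>k > 0\<close> by (intro exI[of _ "1 + k"] conjI exI[of _ 1]) auto
qed


section \<open>Hausdorff measure of Lipschitz boundaries\<close>

text \<open>A box-counting bound, that is, finite upper Minkowski content in dimension s. It is
  stronger than finite Hausdorff measure, but it can be read off from a volume comparison.\<close>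

definition covering_dim_le :: "real \<Rightarrow> 'a::metric_space set \<Rightarrow> bool" where
  "covering_dim_le s A \<longleftrightarrow> (\<exists>C\<ge>0. \<forall>\<delta>. 0 < \<delta> \<and> \<delta> \<le> 1 \<longrightarrow> (\<exists>\<U>. finite \<U> \<and> A \<subseteq> \<Union>\<U> \<and>
     (\<forall>U\<in>\<U>. bounded U \<and> diameter U \<le> \<delta>) \<and> real (card \<U>) * \<delta> powr s \<le> C))"

lemma covering_dim_le_mono: "covering_dim_le s B \<Longrightarrow> A \<subseteq> B \<Longrightarrow> covering_dim_le s A"
  unfolding covering_dim_le_def by (meson order_trans)

lemma covering_dim_le_empty: "covering_dim_le s {}"
  unfolding covering_dim_le_def by (intro exI[of _ 0] conjI allI impI exI[of _ "{}"]) auto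

lemma covering_dim_le_Un:
  assumes "covering_dim_le s A" "covering_dim_le s B"
  shows "covering_dim_le s (A \<union> B)"
proof -
  from assms obtain C1 C2 where "C1 \<ge> 0" "C2 \<ge> 0"
    and 1: "\<And>\<delta>. 0 < \<delta> \<Longrightarrow> \<delta> \<le> 1 \<Longrightarrow> \<exists>\<U>. finite \<U> \<and> A \<subseteq> \<Union>\<U> \<and>
     (\<forall>U\<in>\<U>. bounded U \<and> diameter U \<le> \<delta>) \<and> real (card \<U>) * \<delta> powr s \<le> C1"
    and 2: "\<And>\<delta>. 0 < \<delta> \<Longrightarrow> \<delta> \<le> 1 \<Longrightarrow> \<exists>\<U>. finite \<U> \<and> B \<subseteq> \<Union>\<U> \<and>
     (\<forall>U\<in>\<U>. bounded U \<and> diameter U \<le> \<delta>) \<and> real (card \<U>) * \<delta> powr s \<le> C2"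
    unfolding covering_dim_le_def by metis
  show ?thesis
    unfolding covering_dim_le_def
  proof (intro exI[of _ "C1 + C2"] conjI allI impI)
    show "0 \<le> C1 + C2" using \<open>C1 \<ge> 0\<close> \<open>C2 \<ge> 0\<close> by simp
    fix \<delta> :: real assume d: "0 < \<delta> \<and> \<delta> \<le> 1"
    obtain \<U> where U: "finite \<U>" "A \<subseteq> \<Union>\<U>" "\<forall>U\<in>\<U>. bounded U \<and> diameter U \<le> \<delta>"
      "real (card \<U>) * \<delta> powr s \<le> C1" using 1[of \<delta>] d by blast
    obtain \<V> where V: "finite \<V>" "B \<subseteq> \<Union>\<V>" "\<forall>U\<in>\<V>. bounded U \<and> diameter U \<le> \<delta>"
      "real (card \<V>) * \<delta> powr s \<le> C2" using 2[of \<delta>] d by blast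
    have "real (card (\<U> \<union> \<V>)) * \<delta> powr s \<le> (real (card \<U>) + real (card \<V>)) * \<delta> powr s"
      using card_Un_le[of \<U> \<V>] by (intro mult_right_mono) (auto simp flip: of_nat_add)
    also have "\<dots> \<le> C1 + C2" using U V by (simp add: algebra_simps)
    finally show "\<exists>\<W>. finite \<W> \<and> A \<union> B \<subseteq> \<Union>\<W> \<and>
        (\<forall>U\<in>\<W>. bounded U \<and> diameter U \<le> \<delta>) \<and> real (card \<W>) * \<delta> powr s \<le> C1 + C2"
      using U V by (intro exI[of _ "\<U> \<union> \<V>"]) auto
  qed
qed

lemma covering_dim_le_Union:
  assumes "finite F" "\<And>A. A \<in> F \<Longrightarrow> covering_dim_le s A"
  shows "covering_dim_le s (\<Union>F)"
  using assms by (induction F rule: finite_induct) (auto simp: covering_dim_le_empty covering_dim_le_Un)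

section \<open>From covering numbers to Hausdorff measure\<close>

lemma hausdorff_pre_le_finite_cover:
  assumes "finite \<U>" "A \<subseteq> \<Union>\<U>" "\<forall>U\<in>\<U>. bounded U \<and> diameter U \<le> \<delta>" "0 < \<delta>" "0 \<le> s"
  shows "hausdorff_pre s \<delta> A \<le> ennreal (unit_ball_vol s * (real (card \<U>) * \<delta> powr s))"
proof -
  obtain f where f: "bij_betw f {..<card \<U>} \<U>"
    using assms(1) by (metis ex_bij_betw_nat_finite lessThan_atLeast0)
  \<comment> \<open>Padding with empty sets makes the finite cover a sequence; these have diameter
    0, and \<open>0 powr s\<close> is 0 (also for s = 0), so the series is a finite sum.\<close>
  define U where "U = (\<lambda>i. if i < card \<U> then f i else {})"
  have inU: "f i \<in> \<U>" if "i < card \<U>" for i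
    using f that by (auto simp: bij_betw_def)
  have "(\<Union>i. U i) = \<Union>\<U>"
    using f inU by (auto simp: U_def bij_betw_def split: if_splits) (metis imageE lessThan_iff)
  then have mem: "U \<in> {U. A \<subseteq> (\<Union>i. U i) \<and> (\<forall>i. bounded (U i) \<and> diameter (U i) \<le> \<delta>)}"
    using assms inU by (auto simp: U_def)
  have vol: "unit_ball_vol s \<ge> 0" using assms by simp
  have "hausdorff_pre s \<delta> A \<le> (\<Sum>i. ennreal (unit_ball_vol s * (diameter (U i) / 2) powr s))"
    unfolding hausdorff_pre_def by (rule INF_lower[OF mem])
  also have "\<dots> = (\<Sum>i<card \<U>. ennreal (unit_ball_vol s * (diameter (U i) / 2) powr s))"
    by (rule suminf_finite) (auto simp: U_def)
  also have "\<dots> \<le> (\<Sum>i<card \<U>. ennreal (unit_ball_vol s * \<delta> powr s))"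
  proof (intro sum_mono ennreal_leI mult_left_mono powr_mono2)
    fix i assume "i \<in> {..<card \<U>}"
    then have b: "bounded (U i)" "diameter (U i) \<le> \<delta>" using mem by auto
    then show "0 \<le> diameter (U i) / 2" by (simp add: diameter_ge_0)
    with b show "diameter (U i) / 2 \<le> \<delta>" by simp
  qed (use assms vol in auto)
  also have "\<dots> = ennreal (unit_ball_vol s * (real (card \<U>) * \<delta> powr s))"
    using vol by (simp add: ennreal_mult' mult_ac flip: ennreal_of_nat_eq_real_of_nat)
  finally show ?thesis .
qed

lemma hausdorff_outer_finite:
  assumes "covering_dim_le s A" "0 \<le> s"
  shows "hausdorff_outer s A < \<infinity>"
proof -
  from assms obtain C where C: "\<And>\<delta>. 0 < \<delta> \<Longrightarrow> \<delta> \<le> 1 \<Longrightarrow> \<exists>\<U>. finite \<U> \<and> A \<subseteq> \<Union>\<U> \<and>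
     (\<forall>U\<in>\<U>. bounded U \<and> diameter U \<le> \<delta>) \<and> real (card \<U>) * \<delta> powr s \<le> C"
    unfolding covering_dim_le_def by metis
  have "hausdorff_pre s \<delta> A \<le> ennreal (unit_ball_vol s * C)" if "\<delta> > 0" for \<delta>
  proof -
    \<comment> \<open>Covers are supplied only for scales up to 1. A finer cover is also admissible
      for a larger \<open>\<delta>\<close>, so one constant serves all scales in the
      supremum.\<close>
    define \<epsilon> where "\<epsilon> = min \<delta> 1"
    have e: "0 < \<epsilon>" "\<epsilon> \<le> 1" "\<epsilon> \<le> \<delta>" using that by (auto simp: \<epsilon>_def)
    obtain \<U> where U: "finite \<U>" "A \<subseteq> \<Union>\<U>" "\<forall>U\<in>\<U>. bounded U \<and> diameter U \<le> \<epsilon>"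
      "real (card \<U>) * \<epsilon> powr s \<le> C" using C[OF e(1,2)] by blast
    have "hausdorff_pre s \<delta> A \<le> hausdorff_pre s \<epsilon> A"
      unfolding hausdorff_pre_def using e(3) by (intro INF_superset_mono) (auto intro: order_trans)
    also have "\<dots> \<le> ennreal (unit_ball_vol s * (real (card \<U>) * \<epsilon> powr s))"
      using U e assms by (intro hausdorff_pre_le_finite_cover) auto
    also have "\<dots> \<le> ennreal (unit_ball_vol s * C)"
      using U assms by (intro ennreal_leI mult_left_mono) auto
    finally show ?thesis .
  qed
  then have "hausdorff_outer s A \<le> ennreal (unit_ball_vol s * C)"
    unfolding hausdorff_outer_def by (intro SUP_least) auto
  then show ?thesis by (simp add: le_less_trans)
qed

text \<open>Equality would need the countable additivity of the Hausdorff measure on Borel sets: where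
  that is not known, \<open>measure_of\<close> might be the zero measure.\<close>

lemma emeasure_surface_measure_le:
  "emeasure surface_measure A \<le> hausdorff_outer (real CARD('n) - 1) (A :: (real ^ 'n) set)"
  unfolding surface_measure_def by (simp add: emeasure_measure_of_conv)

text \<open>Each of the separated points is shifted along \<open>e\<close> by multiples of \<open>\<eta>\<close>. The graph condition
  keeps all shifted points apart, so the volume of a ball bounds the number of points by a
  multiple of \<open>\<eta>\<close> to the power \<open>1 - n\<close>.\<close>

lemma card_separated_in_graph:
  fixes e p :: "'a::euclidean_space"
  assumes e: "norm e = 1" and X: "finite X" "X \<subseteq> ball p r" and "0 < r"
    and sep: "\<And>x y. x \<in> X \<Longrightarrow> y \<in> X \<Longrightarrow> x \<noteq> y \<Longrightarrow> \<eta> \<le> norm ((x - y) - ((x - y) \<bullet> e) *\<^sub>R e)"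
    and \<eta>: "0 < \<eta>" "\<eta> \<le> 1"
  shows "real (card X) * \<eta> powr (real DIM('a) - 1) \<le> 2 ^ DIM('a) * (r + 3) ^ DIM('a)"
proof -
  let ?n = "DIM('a)"
  \<comment> \<open>About 1 / \<open>\<eta>\<close> shifts fill a column of height at most 2 over
    each point, so the number of disjoint balls gains the factor 1 / \<open>\<eta>\<close> that
    lowers the dimension by one.\<close>
  define m where "m = nat \<lceil>1 / \<eta>\<rceil>"
  have m: "1 / \<eta> \<le> real m" "real m \<le> 1 / \<eta> + 1"
    using \<eta> by (auto simp: m_def of_nat_ceiling)
  have m\<eta>: "real j * \<eta> \<le> 2" if "j < m" for j
  proof -
    have "real j * \<eta> \<le> real m * \<eta>" using that \<eta> by (intro mult_right_mono) auto
    also have "\<dots> \<le> (1 / \<eta> + 1) * \<eta>" using m \<eta> by (intro mult_right_mono) auto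
    also have "\<dots> \<le> 2" using \<eta> by (simp add: field_simps)
    finally show ?thesis .
  qed
  define P where "P = (\<lambda>(x, j). x + (real j * \<eta>) *\<^sub>R e)"
  define I where "I = X \<times> {..<m}"
  have far: "\<eta> \<le> dist (P a) (P b)" if "a \<in> I" "b \<in> I" "a \<noteq> b" for a b
  proof -
    obtain x i y j where ab: "a = (x, i)" "b = (y, j)" by fastforce
    show ?thesis
    \<comment> \<open>In one column the shifts differ by a multiple of \<open>\<eta>\<close> along
      \<open>e\<close>. In different columns the components orthogonal to \<open>e\<close>, which
      shifting leaves unchanged, are already \<open>\<eta>\<close> apart.\<close>
    proof (cases "x = y")
      case True
      then have "i \<noteq> j" using that ab by auto
      then have "1 \<le> \<bar>real i - real j\<bar>" by linarith
      then have "\<eta> \<le> \<bar>real i - real j\<bar> * \<eta>" using \<eta> by simp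
      also have "\<dots> = norm ((real i * \<eta> - real j * \<eta>) *\<^sub>R e)"
        using e \<eta> by (simp add: abs_mult flip: left_diff_distrib)
      also have "\<dots> = dist (P a) (P b)"
        using True ab by (simp add: P_def dist_norm scaleR_diff_left)
      finally show ?thesis .
    next
      case False
      define w where "w = P a - P b"
      have ee: "e \<bullet> e = 1" using e by (simp add: norm_eq_1)
      have "w - (w \<bullet> e) *\<^sub>R e = (x - y) - ((x - y) \<bullet> e) *\<^sub>R e"
        using ee by (simp add: w_def P_def ab algebra_simps)
      then have "\<eta> \<le> norm (w - (w \<bullet> e) *\<^sub>R e)"
        using sep[of x y] False that ab by (simp add: I_def)
      moreover have "(norm (w - (w \<bullet> e) *\<^sub>R e))\<^sup>2 \<le> (norm w)\<^sup>2"
        using ee by (simp add: power2_norm_eq_inner algebra_simps inner_commute)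
      ultimately show ?thesis
        unfolding w_def dist_norm by (meson norm_ge_zero order_trans power2_le_imp_le)
    qed
  qed
  have fin: "finite I" using X by (simp add: I_def)
  define V where "V = (\<lambda>a. ball (P a) (\<eta> / 2))"
  have disj: "disjoint_family_on V I"
    unfolding disjoint_family_on_def
  proof (intro ballI impI equals0I)
    fix a b z assume ab: "a \<in> I" "b \<in> I" "a \<noteq> b" and "z \<in> V a \<inter> V b"
    then have "dist (P a) z < \<eta> / 2" "dist (P b) z < \<eta> / 2" by (auto simp: V_def)
    then have "dist (P a) (P b) < \<eta>"
      using dist_triangle2[of "P a" "P b" z] by linarith
    then show False using far[OF ab] by simp
  qed
  \<comment> \<open>The 3 is 2 for the largest shift plus 1 for a ball of radius
    \<open>\<eta>\<close> / 2.\<close>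
  have sub: "(\<Union>a\<in>I. V a) \<subseteq> ball p (r + 3)"
  proof clarsimp
    fix x j y assume a: "(x, j) \<in> I" "y \<in> V (x, j)"
    then have "dist p x < r" "j < m" using X by (auto simp: I_def)
    moreover have "dist x (P (x, j)) \<le> 2"
      using m\<eta>[OF \<open>j < m\<close>] e \<eta> by (simp add: P_def dist_norm)
    moreover have "dist (P (x, j)) y < 1"
      using a \<eta> by (simp add: V_def)
    ultimately show "dist p y < r + 3" by metric
  qed
  have "real (card I) * (unit_ball_vol (real ?n) * (\<eta> / 2) ^ ?n) = (\<Sum>a\<in>I. measure lborel (V a))"
    using \<eta> by (simp add: V_def content_ball)
  also have "\<dots> = measure lborel (\<Union>a\<in>I. V a)"
    using fin disj by (intro measure_finite_Union[symmetric]) (auto simp: V_def emeasure_ball \<eta> less_imp_le)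
  also have "\<dots> \<le> measure lborel (ball p (r + 3))"
  proof (rule measure_mono_fmeasurable[OF sub])
    show "(\<Union>a\<in>I. V a) \<in> sets lborel" using fin by (intro sets.finite_UN) (auto simp: V_def)
    show "ball p (r + 3) \<in> fmeasurable lborel"
      by (intro fmeasurableI) (use \<open>0 < r\<close> in \<open>auto simp: emeasure_ball\<close>)
  qed
  also have "\<dots> = unit_ball_vol (real ?n) * (r + 3) ^ ?n"
    using \<open>0 < r\<close> by (simp add: content_ball)
  finally have "unit_ball_vol (real ?n) * (real (card I) * (\<eta> / 2) ^ ?n)
      \<le> unit_ball_vol (real ?n) * (r + 3) ^ ?n"
    by (simp only: mult.left_commute)
  then have "real (card I) * (\<eta> / 2) ^ ?n \<le> (r + 3) ^ ?n"
    by (rule mult_left_le_imp_le) simp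
  then have vol: "real (card X) * real m * \<eta> ^ ?n \<le> 2 ^ ?n * (r + 3) ^ ?n"
    by (simp add: I_def card_cartesian_product power_divide pos_divide_le_eq mult_ac)
  have "real (card X) * \<eta> powr (real ?n - 1) = real (card X) * (1 / \<eta>) * \<eta> ^ ?n"
    using \<eta> by (simp add: powr_diff powr_realpow)
  also have "\<dots> \<le> real (card X) * real m * \<eta> ^ ?n"
    using m \<eta> by (intro mult_right_mono mult_left_mono) auto
  also note vol
  finally show ?thesis .
qed

text \<open>A point left uncovered could be added to a separated set, so one of greatest cardinality
  is a net. The bound N is what makes a greatest cardinality exist.\<close>

lemma maximal_separated_subset:
  fixes T :: "'a::metric_space set"
  assumes "\<And>X. finite X \<Longrightarrow> X \<subseteq> T \<Longrightarrow> (\<And>x y. x \<in> X \<Longrightarrow> y \<in> X \<Longrightarrow> x \<noteq> y \<Longrightarrow> \<delta> \<le> dist x y) \<Longrightarrow> card X \<le> N"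
    and "0 < \<delta>"
  obtains X where "finite X" "X \<subseteq> T" "\<And>x y. x \<in> X \<Longrightarrow> y \<in> X \<Longrightarrow> x \<noteq> y \<Longrightarrow> \<delta> \<le> dist x y"
    "T \<subseteq> (\<Union>x\<in>X. ball x \<delta>)"
proof -
  define Q where "Q = (\<lambda>X. finite X \<and> X \<subseteq> T \<and> (\<forall>x\<in>X. \<forall>y\<in>X. x \<noteq> y \<longrightarrow> \<delta> \<le> dist x y))"
  have "Q {}" by (simp add: Q_def)
  moreover have "\<forall>X. Q X \<longrightarrow> card X < Suc N"
    using assms(1) by (auto simp: Q_def less_Suc_eq_le)
  ultimately obtain X where X: "Q X" "\<And>Y. Q Y \<Longrightarrow> card Y \<le> card X"
    using ex_has_greatest_nat[of Q "{}" card "Suc N"] by blast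
  have "T \<subseteq> (\<Union>x\<in>X. ball x \<delta>)"
  proof (rule ccontr)
    assume "\<not> ?thesis"
    then obtain t where t: "t \<in> T" "\<And>x. x \<in> X \<Longrightarrow> \<delta> \<le> dist x t" by force
    then have "t \<notin> X" using \<open>0 < \<delta>\<close> by force
    have "Q (insert t X)" using X(1) t by (auto simp: Q_def dist_commute)
    then have "card (insert t X) \<le> card X" by (rule X(2))
    then show False using \<open>t \<notin> X\<close> X(1) by (simp add: Q_def)
  qed
  with X(1) show thesis by (intro that[of X]) (simp_all add: Q_def)
qed

text \<open>Along a Lipschitz graph, height differences are controlled by projected distances.
  Separated points of the graph therefore have separated projections, and the volume count bounds
  the size of a net.\<close>

lemma covering_dim_le_lipschitz_graph:
  fixes e p :: "'a::euclidean_space"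
  assumes e: "norm e = 1" and "0 < r" and L: "lipschitz_on L {y. y \<bullet> e = 0} \<gamma>"
    and T: "T \<subseteq> {y \<in> ball p r. \<gamma> (y - (y \<bullet> e) *\<^sub>R e) = y \<bullet> e}"
  shows "covering_dim_le (real DIM('a) - 1) T"
proof -
  let ?n = "DIM('a)"
  let ?s = "real ?n - 1"
  define B where "B = 2 ^ ?n * (r + 3) ^ ?n"
  \<comment> \<open>Balls of radius \<open>\<delta>\<close> / 2 have diameter at most
    \<open>\<delta>\<close>, which gives the 2; passing from distances on the graph to projected
    distances loses 1 + L.\<close>
  define M where "M = 2 * (1 + L)"
  have "L \<ge> 0" using L by (rule lipschitz_on_nonneg)
  then have "M \<ge> 2" by (simp add: M_def)
  have "B \<ge> 0" using \<open>0 < r\<close> by (simp add: B_def)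
  have ee: "e \<bullet> e = 1" using e by (simp add: norm_eq_1)
  have graph: "dist x y \<le> (1 + L) * norm ((x - y) - ((x - y) \<bullet> e) *\<^sub>R e)" if "x \<in> T" "y \<in> T" for x y
  proof -
    define w where "w = (x - y) - ((x - y) \<bullet> e) *\<^sub>R e"
    let ?x = "x - (x \<bullet> e) *\<^sub>R e" and ?y = "y - (y \<bullet> e) *\<^sub>R e"
    have w: "w = ?x - ?y" by (simp add: w_def algebra_simps)
    have "\<bar>(x - y) \<bullet> e\<bar> = dist (\<gamma> ?x) (\<gamma> ?y)"
    proof -
      have "\<gamma> ?x = x \<bullet> e" "\<gamma> ?y = y \<bullet> e" using T that by auto
      then show ?thesis by (simp add: dist_real_def inner_diff_left)
    qed
    also have "\<dots> \<le> L * dist ?x ?y"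
      using L by (rule lipschitz_onD) (simp_all add: ee inner_diff_left)
    finally have "\<bar>(x - y) \<bullet> e\<bar> \<le> L * norm w" by (simp add: w dist_norm)
    moreover have "x - y = w + ((x - y) \<bullet> e) *\<^sub>R e" by (simp add: w_def)
    then have "dist x y \<le> norm w + \<bar>(x - y) \<bullet> e\<bar>"
      using e norm_triangle_ineq[of w "((x - y) \<bullet> e) *\<^sub>R e"] by (simp add: dist_norm)
    ultimately show ?thesis by (simp add: w_def algebra_simps)
  qed
  have "\<exists>\<U>. finite \<U> \<and> T \<subseteq> \<Union>\<U> \<and> (\<forall>U\<in>\<U>. bounded U \<and> diameter U \<le> \<delta>) \<and>
      real (card \<U>) * \<delta> powr ?s \<le> B * M powr ?s" if "0 < \<delta>" "\<delta> \<le> 1" for \<delta>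
  proof -
    define \<eta> where "\<eta> = \<delta> / M"
    have \<eta>: "0 < \<eta>" "\<eta> \<le> 1"
      using that \<open>M \<ge> 2\<close> by (auto simp: \<eta>_def field_simps)
    have bd: "real (card X) * \<eta> powr ?s \<le> B"
      if X: "finite X" "X \<subseteq> T" "\<And>x y. x \<in> X \<Longrightarrow> y \<in> X \<Longrightarrow> x \<noteq> y \<Longrightarrow> \<delta> / 2 \<le> dist x y" for X
      unfolding B_def
    proof (rule card_separated_in_graph[OF e X(1) _ \<open>0 < r\<close> _ \<eta>])
      show "X \<subseteq> ball p r" using X T by blast
      fix x y assume xy: "x \<in> X" "y \<in> X" "x \<noteq> y"
      then have "\<delta> / 2 \<le> (1 + L) * norm ((x - y) - ((x - y) \<bullet> e) *\<^sub>R e)"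
        using X graph[of x y] by force
      then show "\<eta> \<le> norm ((x - y) - ((x - y) \<bullet> e) *\<^sub>R e)"
        using \<open>L \<ge> 0\<close> by (simp add: \<eta>_def M_def field_simps)
    qed
    have "card X \<le> nat \<lceil>B / \<eta> powr ?s\<rceil>"
      if "finite X" "X \<subseteq> T" "\<And>x y. x \<in> X \<Longrightarrow> y \<in> X \<Longrightarrow> x \<noteq> y \<Longrightarrow> \<delta> / 2 \<le> dist x y" for X
    proof -
      have "real (card X) \<le> B / \<eta> powr ?s" using bd[OF that] \<eta> by (simp add: field_simps)
      then show ?thesis by linarith
    qed
    moreover have "0 < \<delta> / 2" using \<open>0 < \<delta>\<close> by simp
    ultimately obtain X where X: "finite X" "X \<subseteq> T"
      "\<And>x y. x \<in> X \<Longrightarrow> y \<in> X \<Longrightarrow> x \<noteq> y \<Longrightarrow> \<delta> / 2 \<le> dist x y" "T \<subseteq> (\<Union>x\<in>X. ball x (\<delta> / 2))"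
      using maximal_separated_subset[of T "\<delta> / 2"] by metis
    define \<U> where "\<U> = (\<lambda>x. ball x (\<delta> / 2)) ` X"
    have "real (card \<U>) * \<delta> powr ?s \<le> real (card X) * \<delta> powr ?s"
      using X(1) by (intro mult_right_mono) (auto simp: \<U>_def card_image_le)
    also have "real (card X) * \<delta> powr ?s = real (card X) * (\<eta> powr ?s * M powr ?s)"
      using that \<open>M \<ge> 2\<close> by (simp add: \<eta>_def flip: powr_mult)
    also have "\<dots> = (real (card X) * \<eta> powr ?s) * M powr ?s" by simp
    also have "\<dots> \<le> B * M powr ?s"
      using bd[OF X(1-3)] by (intro mult_right_mono) auto
    finally show ?thesis
      using X that by (intro exI[of _ \<U>]) (auto simp: \<U>_def)
  qed
  moreover have "B * M powr ?s \<ge> 0" using \<open>B \<ge> 0\<close> by simp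
  ultimately show ?thesis unfolding covering_dim_le_def by blast
qed

text \<open>With F the graph function minus the height, \<open>\<Omega>\<close> is F < 0 inside the
  ball. A frontier point is outside the open set \<open>\<Omega>\<close>, so F \<ge> 0 there; if F >
  0, continuity would give a neighbourhood that misses \<open>\<Omega>\<close>.\<close>

lemma frontier_in_graph:
  fixes e p :: "'a::euclidean_space"
  assumes "open \<Omega>" and e: "norm e = 1" and L: "lipschitz_on L {y. y \<bullet> e = 0} \<gamma>"
    and loc: "\<Omega> \<inter> ball p r = {y \<in> ball p r. \<gamma> (y - (y \<bullet> e) *\<^sub>R e) < y \<bullet> e}"
  shows "frontier \<Omega> \<inter> ball p r \<subseteq> {y \<in> ball p r. \<gamma> (y - (y \<bullet> e) *\<^sub>R e) = y \<bullet> e}"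
proof clarsimp
  fix y assume y: "y \<in> frontier \<Omega>" "dist p y < r"
  have ee: "e \<bullet> e = 1" using e by (simp add: norm_eq_1)
  define F where "F = (\<lambda>y. \<gamma> (y - (y \<bullet> e) *\<^sub>R e) - y \<bullet> e)"
  have "continuous_on UNIV F" unfolding F_def
    by (intro continuous_intros continuous_on_compose2[OF lipschitz_on_continuous_on[OF L]])
       (auto simp: ee inner_diff_left)
  then have "open {y. 0 < F y}" by (intro open_Collect_less continuous_intros)
  then have op: "open ({y. 0 < F y} \<inter> ball p r)" by (intro open_Int) auto
  have "y \<notin> \<Omega>" using y \<open>open \<Omega>\<close> by (simp add: frontier_def interior_open)
  then have "y \<notin> {y \<in> ball p r. \<gamma> (y - (y \<bullet> e) *\<^sub>R e) < y \<bullet> e}"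
    unfolding loc[symmetric] by simp
  then have "F y \<ge> 0" using y by (simp add: F_def)
  moreover have "\<not> F y > 0"
  proof
    assume "F y > 0"
    then have "y \<in> {y. 0 < F y} \<inter> ball p r" using y by simp
    moreover have "y \<in> closure \<Omega>" using y by (simp add: frontier_def)
    ultimately have "({y. 0 < F y} \<inter> ball p r) \<inter> \<Omega> \<noteq> {}"
      using open_Int_closure_eq_empty[OF op, of \<Omega>] by blast
    then obtain z where z: "z \<in> \<Omega> \<inter> ball p r" "0 < F z" by blast
    then show False unfolding loc by (simp add: F_def)
  qed
  ultimately show "\<gamma> (y - (y \<bullet> e) *\<^sub>R e) = y \<bullet> e" by (simp add: F_def)
qed

lemma covering_dim_le_frontier:
  fixes \<Omega> :: "'a::euclidean_space set"
  assumes "bounded_lipschitz_domain \<Omega>"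
  shows "covering_dim_le (real DIM('a) - 1) (frontier \<Omega>)"
proof -
  have "open \<Omega>" "bounded \<Omega>" using assms by (auto simp: bounded_lipschitz_domain_def)
  have "\<exists>r>0. covering_dim_le (real DIM('a) - 1) (frontier \<Omega> \<inter> ball p r)" if "p \<in> frontier \<Omega>" for p
  proof -
    have "\<exists>e r L \<gamma>. norm e = 1 \<and> r > 0 \<and> lipschitz_on L {y. y \<bullet> e = 0} \<gamma> \<and>
        \<Omega> \<inter> ball p r = {y \<in> ball p r. \<gamma> (y - (y \<bullet> e) *\<^sub>R e) < y \<bullet> e}"
      using assms that by (auto simp only: bounded_lipschitz_domain_def)
    then obtain e r L and \<gamma> :: "'a \<Rightarrow> real" where *: "norm e = 1" "r > 0"
      "lipschitz_on L {y. y \<bullet> e = 0} \<gamma>"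
      "\<Omega> \<inter> ball p r = {y \<in> ball p r. \<gamma> (y - (y \<bullet> e) *\<^sub>R e) < y \<bullet> e}"
      by (elim exE conjE)
    show ?thesis
      using covering_dim_le_lipschitz_graph[OF *(1-3) frontier_in_graph[OF \<open>open \<Omega>\<close> *(1,3,4)]] *(2) by blast
  qed
  then obtain R where R: "\<And>p. p \<in> frontier \<Omega> \<Longrightarrow> R p > 0"
    "\<And>p. p \<in> frontier \<Omega> \<Longrightarrow> covering_dim_le (real DIM('a) - 1) (frontier \<Omega> \<inter> ball p (R p))"
    by metis
  have "compact (frontier \<Omega>)" using \<open>bounded \<Omega>\<close> by (rule compact_frontier_bounded)
  then obtain P where P: "P \<subseteq> frontier \<Omega>" "finite P" "frontier \<Omega> \<subseteq> (\<Union>p\<in>P. ball p (R p))"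
    by (rule compactE_image[where C = "frontier \<Omega>" and f = "\<lambda>p. ball p (R p)"]) (use R in force)+
  have "covering_dim_le (real DIM('a) - 1) (\<Union>((\<lambda>p. frontier \<Omega> \<inter> ball p (R p)) ` P))"
    using P R by (intro covering_dim_le_Union) auto
  then show ?thesis by (rule covering_dim_le_mono) (use P in auto)
qed

lemma surface_measure_frontier_finite:
  fixes \<Omega> :: "(real ^ 'n) set"
  assumes "bounded_lipschitz_domain \<Omega>"
  shows "emeasure surface_measure (frontier \<Omega>) < \<infinity>"
proof -
  have "hausdorff_outer (real CARD('n) - 1) (frontier \<Omega>) < \<infinity>"
    using covering_dim_le_frontier[OF assms] by (intro hausdorff_outer_finite) simp_all
  then show ?thesis using emeasure_surface_measure_le le_less_trans by blast
qed


section \<open>Smooth bump functions\<close>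

text \<open>The j-th derivative of exp(-1/t) is p(1/t) exp(-1/t) with p =
  \<open>bump_poly j\<close>. Differentiating once more replaces p by X^2 (p - p'), and
  \<open>[:0, 0, 1:]\<close> is X^2.\<close>

fun bump_poly :: "nat \<Rightarrow> real poly" where
  "bump_poly 0 = 1"
| "bump_poly (Suc j) = [:0, 0, 1:] * (bump_poly j - pderiv (bump_poly j))"

definition flat_exp :: "nat \<Rightarrow> real \<Rightarrow> real" where
  "flat_exp j t = (if t > 0 then poly (bump_poly j) (1 / t) * exp (- (1 / t)) else 0)"

lemma poly_times_exp_minus_tendsto_0: "((\<lambda>x::real. poly p x * exp (- x)) \<longlongrightarrow> 0) at_top"
proof -
  have "((\<lambda>x. \<Sum>i\<le>degree p. coeff p i * (x ^ i / exp x)) \<longlongrightarrow> (\<Sum>i\<le>degree p. coeff p i * 0)) at_top"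
    by (intro tendsto_sum tendsto_mult_left tendsto_power_div_exp_0)
  then show ?thesis
    by (simp add: poly_altdef exp_minus divide_inverse sum_distrib_right mult.assoc)
qed

lemma DERIV_flat_exp: "(flat_exp j has_real_derivative flat_exp (Suc j) t) (at t)"
proof -
  consider "t > 0" | "t < 0" | "t = 0" by linarith
  then show ?thesis
  proof cases
    case 1
    have "((\<lambda>t. poly (bump_poly j) (1 / t) * exp (- (1 / t))) has_real_derivative
        poly (bump_poly (Suc j)) (1 / t) * exp (- (1 / t))) (at t)"
      using 1 by (auto intro!: derivative_eq_intros DERIV_chain2[OF poly_DERIV]
          simp: field_simps power2_eq_square)
    then have "((\<lambda>t. poly (bump_poly j) (1 / t) * exp (- (1 / t))) has_real_derivative
        flat_exp (Suc j) t) (at t)"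
      using 1 by (simp add: flat_exp_def)
    then show ?thesis
      by (rule has_field_derivative_transform_within_open[where S = "{0<..}"])
         (use 1 in \<open>auto simp: flat_exp_def\<close>)
  next
    case 2
    have "((\<lambda>_. 0) has_real_derivative flat_exp (Suc j) t) (at t)"
      using 2 by (simp add: flat_exp_def)
    then show ?thesis
      by (rule has_field_derivative_transform_within_open[where S = "{..<0}"])
         (use 2 in \<open>auto simp: flat_exp_def\<close>)
  next
    case 3
    have "((\<lambda>h. flat_exp j h / h) \<longlongrightarrow> 0) (at 0)"
    proof (rule filterlim_split_at)
      have "eventually (\<lambda>h. flat_exp j h / h = 0) (at_left 0)"
        by (auto simp: eventually_at_left_field flat_exp_def intro: exI[of _ "-1"])
      then show "((\<lambda>h. flat_exp j h / h) \<longlongrightarrow> 0) (at_left 0)"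
        by (simp add: tendsto_eventually)
      \<comment> \<open>The difference quotient at 0 has an additional factor 1 / h, which
        \<open>pCons 0\<close> absorbs into the polynomial; with 1 / h tending to infinity the
        exponential wins.\<close>
      have "((\<lambda>h. poly (pCons 0 (bump_poly j)) (inverse h) * exp (- inverse h)) \<longlongrightarrow> 0) (at_right 0)"
        by (rule filterlim_compose[OF poly_times_exp_minus_tendsto_0 filterlim_inverse_at_top_right])
      moreover have "eventually (\<lambda>h. poly (pCons 0 (bump_poly j)) (inverse h) * exp (- inverse h)
          = flat_exp j h / h) (at_right 0)"
        by (auto simp: eventually_at_right_field flat_exp_def field_simps intro: exI[of _ 1])
      ultimately show "((\<lambda>h. flat_exp j h / h) \<longlongrightarrow> 0) (at_right 0)"
        by (rule Lim_transform_eventually)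
    qed
    then show ?thesis by (simp add: 3 has_field_derivative_iff flat_exp_def)
  qed
qed

text \<open>The profile q of the overview is \<open>cutoff 0\<close>, and \<open>cutoff j\<close> is
  its j-th derivative: the sign undoes the reflection s to 1 - s. The argument will be a squared
  distance, so that no square root spoils smoothness at the centre.\<close>

definition cutoff :: "nat \<Rightarrow> real \<Rightarrow> real" where
  "cutoff j s = (- 1) ^ j * flat_exp j (1 - s)"

lemma DERIV_cutoff: "(cutoff j has_real_derivative cutoff (Suc j) s) (at s)"
  unfolding cutoff_def[abs_def]
  by (rule derivative_eq_intros DERIV_chain2[OF DERIV_flat_exp] refl | simp)+

lemma cutoff_eq_0: "1 \<le> s \<Longrightarrow> cutoff j s = 0"
  by (simp add: cutoff_def flat_exp_def)

lemma cutoff_0_pos: "s < 1 \<Longrightarrow> 0 < cutoff 0 s"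
  by (simp add: cutoff_def flat_exp_def)

lemma cutoff_0_nonneg: "0 \<le> cutoff 0 s"
  by (simp add: cutoff_def flat_exp_def)

lemma continuous_on_cutoff [continuous_intros]:
  "continuous_on S f \<Longrightarrow> continuous_on S (\<lambda>x. cutoff j (f x))"
  by (rule continuous_on_compose2[where t = UNIV and g = "cutoff j"])
     (auto intro: DERIV_continuous_on has_field_derivative_at_within DERIV_cutoff)

lemma has_derivative_cutoff [derivative_intros]:
  assumes "(f has_derivative f') (at x within S)"
  shows "((\<lambda>x. cutoff j (f x)) has_derivative (\<lambda>h. f' h * cutoff (Suc j) (f x))) (at x within S)"
  using DERIV_compose_FDERIV[OF DERIV_cutoff assms] .

section \<open>Test functions built from the cutoff\<close>

lemma test_function_coinduct:
  fixes \<phi> :: "real ^ 'n \<Rightarrow> real"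
  assumes "\<phi> \<in> A" "compact (closure {x. \<phi> x \<noteq> 0})"
    and "\<And>f x. f \<in> A \<Longrightarrow> f differentiable (at x)" "\<And>f i. f \<in> A \<Longrightarrow> partial_deriv i f \<in> A"
  shows "test_function \<phi>"
proof -
  have "foldr partial_deriv is \<phi> \<in> A" for "is"
    by (induction "is") (use assms in auto)
  then show ?thesis using assms unfolding test_function_def by blast
qed

lemma partial_deriv_eq:
  assumes "(\<phi> has_derivative \<phi>') (at x)"
  shows "partial_deriv i \<phi> x = \<phi>' (axis i 1)"
  using frechet_derivative_at[OF assms] by (simp add: partial_deriv_def)

lemma support_partial_deriv:
  "{x. partial_deriv i \<phi> x \<noteq> 0} \<subseteq> closure {x. \<phi> x \<noteq> 0}"
proof (rule subsetI, rule ccontr)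
  fix x assume x: "x \<in> {x. partial_deriv i \<phi> x \<noteq> 0}" "x \<notin> closure {x. \<phi> x \<noteq> 0}"
  have "((\<lambda>_. 0) has_derivative (\<lambda>_. 0)) (at x)" by simp
  then have "(\<phi> has_derivative (\<lambda>_. 0)) (at x)"
    by (rule has_derivative_transform_within_open[where s = "- closure {x. \<phi> x \<noteq> 0}"])
       (use x closure_subset[of "{x. \<phi> x \<noteq> 0}"] in auto)
  then show False using partial_deriv_eq x by fastforce
qed

lemma test_function_partial_deriv:
  assumes "test_function \<phi>"
  shows "test_function (partial_deriv i \<phi>)"
  unfolding test_function_def
proof (intro conjI allI)
  fix "is" x
  \<comment> \<open>\<open>foldr\<close> applies the last list entry first, so an appended index is
    the innermost derivative.\<close>
  have "foldr partial_deriv (is @ [i]) \<phi> differentiable (at x)"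
    using assms unfolding test_function_def by blast
  then show "foldr partial_deriv is (partial_deriv i \<phi>) differentiable (at x)" by simp
  have "closure {x. partial_deriv i \<phi> x \<noteq> 0} \<subseteq> closure {x. \<phi> x \<noteq> 0}"
    by (rule closure_minimal[OF support_partial_deriv]) simp
  then show "compact (closure {x. partial_deriv i \<phi> x \<noteq> 0})"
    using assms by (auto simp: test_function_def compact_eq_bounded_closed intro: bounded_subset)
qed

lemma test_function_continuous: "test_function \<phi> \<Longrightarrow> continuous_on S \<phi>"
  unfolding test_function_def
  by (metis continuous_at_imp_continuous_on differentiable_imp_continuous_within foldr_Nil id_apply)

text \<open>\<open>test_function\<close> speaks of all iterated partial derivatives, so an invariant
  class is required. Linear functions join the cutoffs as generators because the chain rule produces
  them from the squared distance.\<close>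

inductive_set cutoff_algebra :: "real \<Rightarrow> real ^ 'n \<Rightarrow> (real ^ 'n \<Rightarrow> real) set" for c a where
  const: "(\<lambda>_. r) \<in> cutoff_algebra c a"
| inner: "(\<lambda>y. h \<bullet> (y - a)) \<in> cutoff_algebra c a"
| cutoff: "(\<lambda>y. cutoff j (c * ((y - a) \<bullet> (y - a)))) \<in> cutoff_algebra c a"
| add: "f \<in> cutoff_algebra c a \<Longrightarrow> g \<in> cutoff_algebra c a \<Longrightarrow> (\<lambda>y. f y + g y) \<in> cutoff_algebra c a"
| mult: "f \<in> cutoff_algebra c a \<Longrightarrow> g \<in> cutoff_algebra c a \<Longrightarrow> (\<lambda>y. f y * g y) \<in> cutoff_algebra c a"

lemma cutoff_algebra_derivative:
  assumes "f \<in> cutoff_algebra c a"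
  shows "\<exists>f'. (\<forall>y. (f has_derivative f' y) (at y)) \<and> (\<forall>v. (\<lambda>y. f' y v) \<in> cutoff_algebra c a)"
  using assms
proof induction
  case (const r)
  show ?case
    by (intro exI[of _ "\<lambda>_ _. 0"] conjI allI) (auto intro: cutoff_algebra.const)
next
  case (inner h)
  show ?case
    by (intro exI[of _ "\<lambda>_ v. h \<bullet> v"] conjI allI)
       (auto intro!: derivative_eq_intros cutoff_algebra.const)
next
  case (cutoff j)
  have "((\<lambda>y. cutoff j (c * ((y - a) \<bullet> (y - a)))) has_derivative
      (\<lambda>v. 2 * c * (v \<bullet> (y - a)) * cutoff (Suc j) (c * ((y - a) \<bullet> (y - a))))) (at y)" for y
    by (auto intro!: derivative_eq_intros simp: algebra_simps inner_commute)
  moreover have "(\<lambda>y. 2 * c * (v \<bullet> (y - a)) * cutoff (Suc j) (c * ((y - a) \<bullet> (y - a))))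
      \<in> cutoff_algebra c a" for v
    by (intro cutoff_algebra.intros)
  ultimately show ?case
    by (intro exI[of _ "\<lambda>y v. 2 * c * (v \<bullet> (y - a)) * cutoff (Suc j) (c * ((y - a) \<bullet> (y - a)))"]) simp
next
  case (add f g)
  then obtain f' g' where "\<And>y. (f has_derivative f' y) (at y)" "\<And>v. (\<lambda>y. f' y v) \<in> cutoff_algebra c a"
    "\<And>y. (g has_derivative g' y) (at y)" "\<And>v. (\<lambda>y. g' y v) \<in> cutoff_algebra c a" by blast
  then show ?case
    by (intro exI[of _ "\<lambda>y v. f' y v + g' y v"])
       (auto intro!: derivative_intros cutoff_algebra.add)
next
  case (mult f g)
  then obtain f' g' where "\<And>y. (f has_derivative f' y) (at y)" "\<And>v. (\<lambda>y. f' y v) \<in> cutoff_algebra c a"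
    "\<And>y. (g has_derivative g' y) (at y)" "\<And>v. (\<lambda>y. g' y v) \<in> cutoff_algebra c a" by blast
  with mult show ?case
    by (intro exI[of _ "\<lambda>y v. f y * g' y v + f' y v * g y"])
       (auto intro!: derivative_intros cutoff_algebra.add cutoff_algebra.mult)
qed

lemma cutoff_algebra_test_function:
  assumes "\<phi> \<in> cutoff_algebra c a" "compact (closure {x. \<phi> x \<noteq> 0})"
  shows "test_function \<phi>"
proof (rule test_function_coinduct[OF assms])
  fix f :: "real ^ 'a \<Rightarrow> real" assume "f \<in> cutoff_algebra c a"
  then obtain f' where f': "\<And>y. (f has_derivative f' y) (at y)" "\<And>v. (\<lambda>y. f' y v) \<in> cutoff_algebra c a"
    using cutoff_algebra_derivative by blast
  show "f differentiable (at x)" for x using f' by (auto simp: differentiable_def)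
  have "partial_deriv i f = (\<lambda>y. f' y (axis i 1))" for i
    using f' by (auto intro: partial_deriv_eq)
  then show "partial_deriv i f \<in> cutoff_algebra c a" for i using f' by simp
qed

text \<open>The function psi of the overview, centred at \<open>a\<close>, with \<open>c\<close> in
  place of 1 / \<open>\<epsilon>\<close>^2.\<close>

definition directional_bump :: "real \<Rightarrow> real ^ 'n \<Rightarrow> real ^ 'n \<Rightarrow> real ^ 'n \<Rightarrow> real" where
  "directional_bump c a h y = (h \<bullet> (y - a)) * cutoff 0 (c * ((y - a) \<bullet> (y - a)))"

lemma cutoff_support:
  fixes a y :: "'a::real_inner"
  assumes "0 < \<epsilon>" "y \<notin> ball a \<epsilon>"
  shows "cutoff j (1 / \<epsilon>\<^sup>2 * ((y - a) \<bullet> (y - a))) = 0"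
proof (rule cutoff_eq_0)
  have "\<epsilon> \<le> norm (y - a)" using assms by (simp add: dist_norm norm_minus_commute)
  then have "\<epsilon>\<^sup>2 \<le> (norm (y - a))\<^sup>2" using assms by (intro power_mono) auto
  then show "1 \<le> 1 / \<epsilon>\<^sup>2 * ((y - a) \<bullet> (y - a))"
    using assms by (simp add: power2_norm_eq_inner)
qed

lemma directional_bump_support:
  assumes "0 < \<epsilon>"
  shows "closure {y. directional_bump (1 / \<epsilon>\<^sup>2) a h y \<noteq> 0} \<subseteq> cball a \<epsilon>"
  by (rule closure_minimal) (use cutoff_support[OF assms] in \<open>force simp: directional_bump_def\<close>, simp)

lemma test_function_directional_bump:
  fixes a h :: "real ^ 'n"
  assumes "0 < \<epsilon>"
  shows "test_function (directional_bump (1 / \<epsilon>\<^sup>2) a h)"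
proof (rule cutoff_algebra_test_function)
  show "directional_bump (1 / \<epsilon>\<^sup>2) a h \<in> cutoff_algebra (1 / \<epsilon>\<^sup>2) a"
    unfolding directional_bump_def[abs_def] by (intro cutoff_algebra.intros)
  have "bounded (closure {y. directional_bump (1 / \<epsilon>\<^sup>2) a h y \<noteq> 0})"
    using directional_bump_support[OF assms] bounded_cball by (rule bounded_subset[rotated])
  then show "compact (closure {y. directional_bump (1 / \<epsilon>\<^sup>2) a h y \<noteq> 0})"
    by (simp add: compact_eq_bounded_closed)
qed

text \<open>Apply the product rule to (h . w) g with g = q(c |w|^2). In the factor n + 2, the n
  comes from the Laplacian of |w|^2 and the 2 from the cross term 2 h . grad g.\<close>

lemma laplacian_directional_bump:
  fixes a h y :: "real ^ 'n"
  shows "(\<Sum>i\<in>UNIV. partial_deriv i (partial_deriv i (directional_bump c a h)) y)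
    = 2 * c * (h \<bullet> (y - a)) * ((real CARD('n) + 2) * cutoff 1 (c * ((y - a) \<bullet> (y - a)))
      + 2 * (c * ((y - a) \<bullet> (y - a))) * cutoff 2 (c * ((y - a) \<bullet> (y - a))))"
proof -
  define s where "s = (\<lambda>y. c * ((y - a) \<bullet> (y - a)))"
  define w where "w = y - a"
  have ds: "(s has_derivative (\<lambda>v. 2 * c * ((y - a) \<bullet> v))) (at y)" for y
    unfolding s_def by (auto intro!: derivative_eq_intros simp: algebra_simps inner_commute)
  have db: "directional_bump c a h = (\<lambda>y. (h \<bullet> (y - a)) * cutoff 0 (s y))"
    by (simp add: fun_eq_iff directional_bump_def s_def)
  have d1: "partial_deriv i (directional_bump c a h) y
      = (h \<bullet> axis i 1) * cutoff 0 (s y) + (h \<bullet> (y - a)) * (2 * c * ((y - a) \<bullet> axis i 1) * cutoff 1 (s y))" for i y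
    unfolding db by (rule trans[OF partial_deriv_eq]) (rule derivative_eq_intros ds refl | simp)+
  have d2: "partial_deriv i (partial_deriv i (directional_bump c a h)) y
      = 4 * c * cutoff 1 (s y) * (h $ i * w $ i) + 2 * c * (h \<bullet> w) * cutoff 1 (s y)
        + 4 * c\<^sup>2 * (h \<bullet> w) * cutoff 2 (s y) * (w $ i * w $ i)" for i
    unfolding d1[abs_def]
    by (rule trans[OF partial_deriv_eq], (rule derivative_eq_intros ds refl)+)
       (simp add: inner_axis w_def numeral_2_eq_2 power2_eq_square, simp add: algebra_simps)
  have "(\<Sum>i\<in>UNIV. h $ i * w $ i) = h \<bullet> w" "(\<Sum>i\<in>UNIV. w $ i * w $ i) = w \<bullet> w"
    by (simp_all add: inner_vec_def)
  moreover have "c * ((y - a) \<bullet> (y - a)) = s y" "y - a = w" "s y = c * (w \<bullet> w)"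
    by (simp_all add: s_def w_def)
  moreover define A B where "A = cutoff 1 (s y)" and "B = cutoff 2 (s y)"
  ultimately show ?thesis
    unfolding d2 sum.distrib sum_distrib_left[symmetric]
    by (simp add: algebra_simps power2_eq_square flip: A_def B_def)
qed


section \<open>Interior regularity\<close>

text \<open>A bound that also covers integrands that are not integrable: their Bochner integral is 0
  by convention. The boundary integral can thus be estimated from pointwise bounds alone.\<close>

lemma norm_set_integral_le:
  fixes f :: "'a \<Rightarrow> 'b::{banach, second_countable_topology}"
  assumes A: "A \<in> sets M" "emeasure M A < \<infinity>" and "0 \<le> B" and B: "\<And>x. x \<in> A \<Longrightarrow> norm (f x) \<le> B"
  shows "norm (LINT x:A|M. f x) \<le> B * measure M A"
proof (cases "set_integrable M A f")
  case True
  have "ennreal (norm (LINT x:A|M. f x)) \<le> (\<integral>\<^sup>+x. norm (indicator A x *\<^sub>R f x) \<partial>M)"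
    using True unfolding set_lebesgue_integral_def set_integrable_def by (rule integral_norm_bound_ennreal)
  also have "\<dots> \<le> (\<integral>\<^sup>+x. ennreal B * indicator A x \<partial>M)"
    by (intro nn_integral_mono) (auto simp: indicator_def intro!: ennreal_leI B)
  also have "\<dots> = ennreal (B * measure M A)"
    using A \<open>0 \<le> B\<close> by (simp add: nn_integral_cmult_indicator emeasure_eq_ennreal_measure ennreal_mult)
  finally show ?thesis using \<open>0 \<le> B\<close> by simp
next
  case False
  then show ?thesis
    using \<open>0 \<le> B\<close> by (simp add: set_lebesgue_integral_def set_integrable_def not_integrable_integral_eq)
qed

text \<open>Local square integrability dominates local integrability on the compact support through
  t \<le> 1 + t^2.\<close>

lemma integrable_test_function_scaleR:
  fixes f :: "real ^ 'n \<Rightarrow> 'b::euclidean_space"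
  assumes \<phi>: "test_function \<phi>" and f: "L2_loc f"
  shows "integrable lebesgue (\<lambda>x. \<phi> x *\<^sub>R f x)"
proof -
  define K where "K = closure {x. \<phi> x \<noteq> 0}"
  have "compact K" using \<phi> by (simp add: K_def test_function_def)
  have cont: "continuous_on S \<phi>" for S using \<phi> by (rule test_function_continuous)
  have "compact (\<phi> ` K)" using cont \<open>compact K\<close> by (rule compact_continuous_image)
  then obtain B where B: "B > 0" "\<And>x. x \<in> K \<Longrightarrow> \<bar>\<phi> x\<bar> \<le> B"
    by (force dest: compact_imp_bounded simp: bounded_pos)
  have supp: "\<phi> x = 0" if "x \<notin> K" for x
    using that closure_subset[of "{x. \<phi> x \<noteq> 0}"] by (auto simp: K_def)
  have meas: "\<phi> \<in> borel_measurable lebesgue" "f \<in> borel_measurable lebesgue"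
    using cont f by (auto simp: L2_loc_def intro!: measurable_completion borel_measurable_continuous_onI)
  have "set_integrable lebesgue K (\<lambda>x. (norm (f x))\<^sup>2)"
    using f \<open>compact K\<close> by (simp add: L2_loc_def)
  moreover have "K \<in> lmeasurable" using \<open>compact K\<close> by (rule lmeasurable_compact)
  then have "set_integrable lebesgue K (\<lambda>x. 1::real)"
    unfolding set_integrable_def by (auto simp: fmeasurable_def intro!: integrable_real_indicator)
  ultimately have "set_integrable lebesgue K (\<lambda>x. B * (1 + (norm (f x))\<^sup>2))"
    by (intro set_integrable_mult_right set_integral_add)
  then have "integrable lebesgue (\<lambda>x. indicator K x * (B * (1 + (norm (f x))\<^sup>2)))"
    by (simp add: set_integrable_def)
  then show ?thesis
  proof (rule Bochner_Integration.integrable_bound)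
    show "(\<lambda>x. \<phi> x *\<^sub>R f x) \<in> borel_measurable lebesgue" using meas by measurable
    show "AE x in lebesgue. norm (\<phi> x *\<^sub>R f x) \<le> norm (indicator K x * (B * (1 + (norm (f x))\<^sup>2)))"
    proof (rule AE_I2)
      fix x
      have "norm (f x) \<le> 1 + (norm (f x))\<^sup>2"
        using zero_le_power2[of "norm (f x) - 1 / 2"] by (simp add: power2_eq_square algebra_simps)
      then have "x \<in> K \<Longrightarrow> \<bar>\<phi> x\<bar> * norm (f x) \<le> B * (1 + (norm (f x))\<^sup>2)"
        using B by (intro mult_mono) auto
      then show "norm (\<phi> x *\<^sub>R f x) \<le> norm (indicator K x * (B * (1 + (norm (f x))\<^sup>2)))"
        using supp[of x] B by (cases "x \<in> K") auto
    qed
  qed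
qed

text \<open>The definition of the weak gradient, used with the partial derivatives of
  \<open>\<phi>\<close> as test functions, moves the second derivative onto \<open>\<phi>\<close>.
  On the support the contrast vanishes, which leaves the constant coefficient.\<close>

lemma weak_helmholtz_solution_distributional:
  assumes u: "weak_helmholtz_solution k \<eta> u" and \<phi>: "test_function \<phi>"
    and \<eta>: "\<And>x. \<phi> x \<noteq> 0 \<Longrightarrow> \<eta> x = 0"
  shows "(LINT x|lebesgue. (\<Sum>i\<in>UNIV. partial_deriv i (partial_deriv i \<phi>) x) *\<^sub>R u x)
    = - of_real (k\<^sup>2) * (LINT x|lebesgue. \<phi> x *\<^sub>R u x)"
proof -
  obtain g where "L2_loc u" "L2_loc g" and g: "weak_gradient u g"
    and weak: "\<And>\<phi>. test_function \<phi> \<Longrightarrow>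
      (LINT x|lebesgue. (\<Sum>i\<in>UNIV. partial_deriv i \<phi> x *\<^sub>R (g x $ i)))
        = (LINT x|lebesgue. \<phi> x *\<^sub>R (of_real (k\<^sup>2) * (1 + \<eta> x) * u x))"
    using u unfolding weak_helmholtz_solution_def by blast
  have t1: "test_function (partial_deriv i \<phi>)" and t2: "test_function (partial_deriv i (partial_deriv i \<phi>))" for i
    using \<phi> by (auto intro: test_function_partial_deriv)
  have ig: "integrable lebesgue (\<lambda>x. partial_deriv i \<phi> x *\<^sub>R (g x $ i))" for i
    using integrable_bounded_linear[OF bounded_linear_vec_nth
        integrable_test_function_scaleR[OF t1 \<open>L2_loc g\<close>], of i i] by simp
  have iu: "integrable lebesgue (\<lambda>x. partial_deriv i (partial_deriv i \<phi>) x *\<^sub>R u x)" for i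
    by (rule integrable_test_function_scaleR[OF t2 \<open>L2_loc u\<close>])
  have "(LINT x|lebesgue. (\<Sum>i\<in>UNIV. partial_deriv i (partial_deriv i \<phi>) x) *\<^sub>R u x)
      = (\<Sum>i\<in>UNIV. LINT x|lebesgue. partial_deriv i (partial_deriv i \<phi>) x *\<^sub>R u x)"
    unfolding scaleR_sum_left by (rule Bochner_Integration.integral_sum) (rule iu)
  also have "\<dots> = (\<Sum>i\<in>UNIV. - (LINT x|lebesgue. partial_deriv i \<phi> x *\<^sub>R (g x $ i)))"
    using g t1 unfolding weak_gradient_def by (intro sum.cong) auto
  also have "\<dots> = - (LINT x|lebesgue. (\<Sum>i\<in>UNIV. partial_deriv i \<phi> x *\<^sub>R (g x $ i)))"
    by (subst Bochner_Integration.integral_sum[OF ig]) (simp add: sum_negf)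
  also have "\<dots> = - (LINT x|lebesgue. \<phi> x *\<^sub>R (of_real (k\<^sup>2) * (1 + \<eta> x) * u x))"
    by (simp only: weak[OF \<phi>])
  also have "(\<lambda>x. \<phi> x *\<^sub>R (of_real (k\<^sup>2) * (1 + \<eta> x) * u x)) = (\<lambda>x. of_real (k\<^sup>2) * (\<phi> x *\<^sub>R u x))"
  proof
    fix x show "\<phi> x *\<^sub>R (of_real (k\<^sup>2) * (1 + \<eta> x) * u x) = of_real (k\<^sup>2) * (\<phi> x *\<^sub>R u x)"
      using \<eta>[of x] by (cases "\<phi> x = 0") auto
  qed
  also have "- (LINT x|lebesgue. of_real (k\<^sup>2) * (\<phi> x *\<^sub>R u x))
      = - of_real (k\<^sup>2) * (LINT x|lebesgue. \<phi> x *\<^sub>R u x)"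
    by (simp only: Bochner_Integration.integral_mult_right_zero mult_minus_left)
  finally show ?thesis .
qed

text \<open>A bridge between two integrals: the weak equation uses the Bochner integral, while
  differentiation under the integral sign is carried out with the gauge integral on a box.\<close>

lemma lebesgue_integral_eq_integral_cbox:
  fixes f :: "'a::euclidean_space \<Rightarrow> 'b::euclidean_space"
  assumes "continuous_on (cbox a b) f" "\<And>x. x \<notin> cbox a b \<Longrightarrow> f x = 0"
  shows "(LINT x|lebesgue. f x) = integral (cbox a b) f"
proof -
  have "f absolutely_integrable_on cbox a b"
    using assms(1) by (rule absolutely_integrable_continuous)
  then have "(LINT x:cbox a b|lebesgue. f x) = integral (cbox a b) f"
    by (rule set_lebesgue_integral_eq_integral(2))
  moreover have "(\<lambda>x. indicator (cbox a b) x *\<^sub>R f x) = f"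
    using assms(2) by (auto simp: indicator_def fun_eq_iff)
  ultimately show ?thesis by (simp add: set_lebesgue_integral_def)
qed

section \<open>Mollification and its derivatives in position and in scale\<close>

text \<open>The kernel is not normalised; its mass \<open>bump_mass\<close> is divided out at the
  very end. Integrating over a fixed box, on which u is continuous, gives the full convolution as
  soon as the ball of radius \<open>\<epsilon>\<close> about x lies in the box.\<close>

definition mollified :: "real ^ 'n \<Rightarrow> real ^ 'n \<Rightarrow> (real ^ 'n \<Rightarrow> complex) \<Rightarrow> real \<Rightarrow> real ^ 'n \<Rightarrow> complex" where
  "mollified a b u \<epsilon> x = integral (cbox a b)
     (\<lambda>y. (1 / \<epsilon> ^ CARD('n) * cutoff 0 (1 / \<epsilon>\<^sup>2 * ((y - x) \<bullet> (y - x)))) *\<^sub>R u y)"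

definition mollified_deriv ::
    "real ^ 'n \<Rightarrow> real ^ 'n \<Rightarrow> (real ^ 'n \<Rightarrow> complex) \<Rightarrow> real \<Rightarrow> real ^ 'n \<Rightarrow> real ^ 'n \<Rightarrow> complex" where
  "mollified_deriv a b u \<epsilon> x h = integral (cbox a b)
     (\<lambda>y. (- 2 / \<epsilon> ^ (CARD('n) + 2) * (h \<bullet> (y - x)) * cutoff 1 (1 / \<epsilon>\<^sup>2 * ((y - x) \<bullet> (y - x)))) *\<^sub>R u y)"

lemma mollified_has_derivative:
  fixes u :: "real ^ 'n \<Rightarrow> complex"
  assumes u: "continuous_on (cbox a b) u" and "0 < \<epsilon>" and S: "x \<in> S" "convex S"
  shows "(mollified a b u \<epsilon> has_derivative mollified_deriv a b u \<epsilon> x) (at x within S)"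
proof -
  define f where "f = (\<lambda>x y. (1 / \<epsilon> ^ CARD('n) * cutoff 0 (1 / \<epsilon>\<^sup>2 * ((y - x) \<bullet> (y - x)))) *\<^sub>R u y)"
  define c where "c = (\<lambda>x y :: real ^ 'n. - 2 / \<epsilon> ^ (CARD('n) + 2) * cutoff 1 (1 / \<epsilon>\<^sup>2 * ((y - x) \<bullet> (y - x))))"
  \<comment> \<open>The derivative of the integrand as a rank-one map, written as a composition of
    bounded linear maps because \<open>leibniz_rule\<close> asks for continuity in operator
    norm.\<close>
  define fx where "fx = (\<lambda>x y. blinfun_scaleR_left (u y) o\<^sub>L blinfun_inner_left (c x y *\<^sub>R (y - x)))"
  have fx: "blinfun_apply (fx x y) h =
      (- 2 / \<epsilon> ^ (CARD('n) + 2) * (h \<bullet> (y - x)) * cutoff 1 (1 / \<epsilon>\<^sup>2 * ((y - x) \<bullet> (y - x)))) *\<^sub>R u y" for x y h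
    by (simp add: fx_def c_def mult_ac)
  have cu: "continuous_on T (\<lambda>z. u (g z))" if "continuous_on T g" "g ` T \<subseteq> cbox a b"
    for T and g :: "_ \<Rightarrow> real ^ 'n"
    using continuous_on_compose2[OF u that] .
  have "((\<lambda>x. integral (cbox a b) (f x)) has_derivative integral (cbox a b) (fx x)) (at x within S)"
  proof (rule leibniz_rule[OF _ _ _ S])
    show "((\<lambda>x. f x y) has_derivative blinfun_apply (fx x y)) (at x within S)" for x y
      unfolding f_def
      by (rule has_derivative_eq_rhs, (rule derivative_eq_intros refl)+)
         (auto simp: fun_eq_iff fx inner_commute power_add power2_eq_square field_simps)
  next
    show "f x integrable_on cbox a b" for x
      unfolding f_def by (intro integrable_continuous continuous_intros u)
  next
    show "continuous_on (S \<times> cbox a b) (\<lambda>(x, y). fx x y)"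
      unfolding fx_def c_def split_beta
      by (intro continuous_intros bounded_linear.continuous_on[OF bounded_linear_blinfun_inner_left]
            bounded_linear.continuous_on[OF bounded_linear_blinfun_scaleR_left] cu
            bounded_bilinear.continuous_on[OF bounded_bilinear_blinfun_compose]) auto
  qed
  moreover have "fx x integrable_on cbox a b"
    unfolding fx_def c_def
    by (intro integrable_continuous continuous_intros bounded_linear.continuous_on[OF bounded_linear_blinfun_inner_left]
            bounded_linear.continuous_on[OF bounded_linear_blinfun_scaleR_left] u
            bounded_bilinear.continuous_on[OF bounded_bilinear_blinfun_compose])
  then have "blinfun_apply (integral (cbox a b) (fx x)) = mollified_deriv a b u \<epsilon> x"
    by (auto simp: fun_eq_iff blinfun_apply_integral fx mollified_deriv_def)
  moreover have "(\<lambda>x. integral (cbox a b) (f x)) = mollified a b u \<epsilon>"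
    by (simp add: fun_eq_iff f_def mollified_def)
  ultimately show ?thesis by simp
qed

text \<open>The central identity of the overview. It holds for the kernels pointwise in y and is
  then integrated against u; the differential equation for u does not enter yet.\<close>

lemma mollified_deriv_scale_derivative:
  fixes u :: "real ^ 'n \<Rightarrow> complex"
  assumes u: "continuous_on (cbox a b) u" and "0 < \<epsilon>"
  shows "((\<lambda>\<epsilon>. mollified_deriv a b u \<epsilon> x h) has_vector_derivative
    (1 / \<epsilon> ^ (CARD('n) + 1)) *\<^sub>R integral (cbox a b) (\<lambda>y. (\<Sum>i\<in>UNIV.
       partial_deriv i (partial_deriv i (directional_bump (1 / \<epsilon>\<^sup>2) x h)) y) *\<^sub>R u y)) (at \<epsilon> within {0<..})"
proof -
  define s where "s = (\<lambda>\<epsilon> y. 1 / \<epsilon>\<^sup>2 * ((y - x) \<bullet> (y - x)))"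
  define f where "f = (\<lambda>\<epsilon> y. (- 2 / \<epsilon> ^ (CARD('n) + 2) * (h \<bullet> (y - x)) * cutoff 1 (s \<epsilon> y)) *\<^sub>R u y)"
  \<comment> \<open>The common explicit form to which the scale derivative of the kernel and the
    rescaled Laplacian of the bump both reduce.\<close>
  define D where "D = (\<lambda>\<epsilon> y. 2 / \<epsilon> ^ (CARD('n) + 3) * (h \<bullet> (y - x))
    * ((real CARD('n) + 2) * cutoff 1 (s \<epsilon> y) + 2 * s \<epsilon> y * cutoff 2 (s \<epsilon> y)))"
  have cs: "continuous_on ({0<..} \<times> cbox a b) (\<lambda>z. s (fst z) (snd z))"
    unfolding s_def by (intro continuous_intros) auto
  have cu: "continuous_on ({0<..} \<times> cbox a b) (\<lambda>z. u (snd z))"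
    by (rule continuous_on_compose2[OF u]) (auto intro: continuous_intros)
  have "((\<lambda>\<epsilon>. integral (cbox a b) (f \<epsilon>)) has_vector_derivative
      integral (cbox a b) (\<lambda>y. D \<epsilon> y *\<^sub>R u y)) (at \<epsilon> within {0<..})"
  proof (rule leibniz_rule_vector_derivative)
    fix \<epsilon> :: real and y :: "real ^ 'n" assume "\<epsilon> \<in> {0<..}"
    then have "\<epsilon> > 0" by simp
    have ds: "((\<lambda>\<epsilon>. s \<epsilon> y) has_real_derivative - 2 * s \<epsilon> y / \<epsilon>) (at \<epsilon> within {0<..})"
      unfolding s_def using \<open>\<epsilon> > 0\<close>
      by (auto intro!: derivative_eq_intros simp: field_simps power2_eq_square)
    have dp: "((\<lambda>\<epsilon>. - 2 / \<epsilon> ^ (CARD('n) + 2)) has_real_derivative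
        2 * (real CARD('n) + 2) / \<epsilon> ^ (CARD('n) + 3)) (at \<epsilon> within {0<..})"
    proof -
      have pow: "((\<lambda>\<epsilon>. - 2 / \<epsilon> ^ m) has_real_derivative 2 * real m / \<epsilon> ^ (m + 1)) (at \<epsilon> within {0<..})" for m
      proof -
        \<comment> \<open>For m = 0 the truncated exponent m - 1 is harmless, as the factor
          \<open>real m\<close> is 0.\<close>
        have "real m * \<epsilon> ^ (m - 1) / (\<epsilon> ^ m * \<epsilon> ^ m) = real m / \<epsilon> ^ (m + 1)"
          using \<open>\<epsilon> > 0\<close> by (cases m) (auto simp: field_simps)
        then show ?thesis
          using \<open>\<epsilon> > 0\<close> by (auto intro!: derivative_eq_intros)
      qed
      show ?thesis using pow[of "CARD('n) + 2"] by (simp add: numeral_3_eq_3 add.commute)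
    qed
    have "((\<lambda>\<epsilon>. - 2 / \<epsilon> ^ (CARD('n) + 2) * (h \<bullet> (y - x)) * cutoff 1 (s \<epsilon> y)) has_real_derivative
        D \<epsilon> y) (at \<epsilon> within {0<..})"
    proof -
      have "2 * (real CARD('n) + 2) / \<epsilon> ^ (CARD('n) + 3) * (h \<bullet> (y - x)) * cutoff 1 (s \<epsilon> y)
          + - 2 * s \<epsilon> y / \<epsilon> * cutoff 2 (s \<epsilon> y) * (- 2 / \<epsilon> ^ (CARD('n) + 2) * (h \<bullet> (y - x))) = D \<epsilon> y"
        using \<open>\<epsilon> > 0\<close> by (simp add: D_def field_simps power_add power2_eq_square power3_eq_cube)
      then show ?thesis
        by (intro DERIV_cong[OF DERIV_mult[OF DERIV_cmult_right[OF dp] DERIV_chain2[OF DERIV_cutoff ds]]])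
           (simp add: numeral_2_eq_2 algebra_simps)
    qed
    then show "((\<lambda>\<epsilon>. f \<epsilon> y) has_vector_derivative D \<epsilon> y *\<^sub>R u y) (at \<epsilon> within {0<..})"
      unfolding f_def
      by (rule has_vector_derivative_eq_rhs[OF has_vector_derivative_scaleR[OF _ has_vector_derivative_const]]) simp
  next
    fix \<epsilon> :: real assume "\<epsilon> \<in> {0<..}"
    then show "f \<epsilon> integrable_on cbox a b"
      unfolding f_def s_def by (intro integrable_continuous continuous_intros u) auto
  next
    show "continuous_on ({0<..} \<times> cbox a b) (\<lambda>(\<epsilon>, y). D \<epsilon> y *\<^sub>R u y)"
      unfolding D_def split_beta by (intro continuous_intros cs cu) auto
  qed (use \<open>0 < \<epsilon>\<close> in auto)
  moreover have "D \<epsilon> y = 1 / \<epsilon> ^ (CARD('n) + 1) * (\<Sum>i\<in>UNIV.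
       partial_deriv i (partial_deriv i (directional_bump (1 / \<epsilon>\<^sup>2) x h)) y)" for y
    unfolding laplacian_directional_bump D_def s_def
    using \<open>0 < \<epsilon>\<close> by (simp add: power_add power3_eq_cube power2_eq_square mult_ac)
  then have "integral (cbox a b) (\<lambda>y. D \<epsilon> y *\<^sub>R u y) = (1 / \<epsilon> ^ (CARD('n) + 1)) *\<^sub>R
      integral (cbox a b) (\<lambda>y. (\<Sum>i\<in>UNIV.
       partial_deriv i (partial_deriv i (directional_bump (1 / \<epsilon>\<^sup>2) x h)) y) *\<^sub>R u y)"
    by (simp flip: integral_cmul)
  ultimately show ?thesis
    by (simp add: f_def s_def mollified_deriv_def[abs_def])
qed

section \<open>The mollifier as an approximate identity\<close>

lemma cutoff_0_le_1: "cutoff 0 s \<le> 1"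
  by (simp add: cutoff_def flat_exp_def)

text \<open>The box contains the unit ball, outside of which the integrand vanishes, so this is the
  integral over the whole space.\<close>

definition bump_mass :: "'a::euclidean_space itself \<Rightarrow> real" where
  "bump_mass _ = integral (cbox (- One) One) (\<lambda>z::'a. cutoff 0 (z \<bullet> z))"

lemma bump_mass_pos: "0 < bump_mass TYPE('a::euclidean_space)"
proof -
  let ?f = "\<lambda>z::'a. cutoff 0 (z \<bullet> z)"
  have cont: "continuous_on (cbox (- One) One) ?f" by (intro continuous_intros)
  have "0 \<in> box (- One) (One :: 'a)" by (simp add: mem_box)
  then have 0: "box (- One) (One :: 'a) \<noteq> {}" "0 \<in> cbox (- One) (One :: 'a)"
    using box_subset_cbox by blast+
  have "bump_mass TYPE('a) \<noteq> 0"
  proof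
    assume "bump_mass TYPE('a) = 0"
    then have "(?f has_integral 0) (cbox (- One) One)"
      using integrable_integral[OF integrable_continuous[OF cont]] by (simp add: bump_mass_def)
    then have "?f 0 = 0"
      using cont 0 cutoff_0_nonneg by (intro has_integral_0_cbox_imp_0[of "- One" One ?f 0]) auto
    then show False using cutoff_0_pos[of 0] by simp
  qed
  moreover have "0 \<le> bump_mass TYPE('a)"
    unfolding bump_mass_def by (intro integral_nonneg integrable_continuous cont cutoff_0_nonneg)
  ultimately show ?thesis by simp
qed

lemma scaled_cutoff_has_integral:
  fixes x :: "'a::euclidean_space"
  assumes "0 < \<epsilon>" and sub: "cbox (x - \<epsilon> *\<^sub>R One) (x + \<epsilon> *\<^sub>R One) \<subseteq> cbox a b"
  shows "((\<lambda>y. 1 / \<epsilon> ^ DIM('a) * cutoff 0 (1 / \<epsilon>\<^sup>2 * ((y - x) \<bullet> (y - x)))) has_integral bump_mass TYPE('a)) (cbox a b)"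
proof -
  let ?Q = "cbox (x - \<epsilon> *\<^sub>R One) (x + \<epsilon> *\<^sub>R One)"
  define f where "f = (\<lambda>y. cutoff 0 (1 / \<epsilon>\<^sup>2 * ((y - x) \<bullet> (y - x))))"
  have "f integrable_on ?Q" unfolding f_def by (intro integrable_continuous continuous_intros)
  then obtain I where I: "(f has_integral I) ?Q" by blast
  have "((\<lambda>z. f (\<epsilon> *\<^sub>R z + x)) has_integral I /\<^sub>R \<epsilon> ^ DIM('a)) (cbox (- One) One)"
    using has_integral_affinity'[OF I \<open>0 < \<epsilon>\<close>, of x] \<open>0 < \<epsilon>\<close> by simp
  moreover have "(\<lambda>z. f (\<epsilon> *\<^sub>R z + x)) = (\<lambda>z. cutoff 0 (z \<bullet> z))"
    using \<open>0 < \<epsilon>\<close> by (simp add: f_def fun_eq_iff power2_eq_square)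
  ultimately have "bump_mass TYPE('a) = I /\<^sub>R \<epsilon> ^ DIM('a)"
    unfolding bump_mass_def by (simp add: integral_unique)
  moreover have "((\<lambda>y. 1 / \<epsilon> ^ DIM('a) * f y) has_integral 1 / \<epsilon> ^ DIM('a) * I) ?Q"
    using I by (rule has_integral_mult_right)
  ultimately have Q: "((\<lambda>y. 1 / \<epsilon> ^ DIM('a) * f y) has_integral bump_mass TYPE('a)) ?Q"
    by (simp add: field_simps)
  have "f y = 0" if "y \<notin> ?Q" for y
  proof -
    have "y \<notin> ball x \<epsilon>"
    proof
      assume "y \<in> ball x \<epsilon>"
      then have "\<bar>(y - x) \<bullet> i\<bar> < \<epsilon>" if "i \<in> Basis" for i
        using Basis_le_norm[OF that, of "y - x"] by (simp add: dist_norm norm_minus_commute)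
      then have "y \<in> ?Q"
        by (force simp: mem_box inner_diff_left inner_add_left abs_less_iff)
      then show False using that by simp
    qed
    then show ?thesis unfolding f_def by (rule cutoff_support[OF \<open>0 < \<epsilon>\<close>])
  qed
  then show ?thesis
    using has_integral_on_superset[OF Q _ sub] by (simp add: f_def)
qed

lemma mollified_tendsto:
  fixes u :: "real ^ 'n \<Rightarrow> complex"
  assumes u: "continuous_on (cbox a b) u" and "0 < R" and sub: "cbox (x - R *\<^sub>R One) (x + R *\<^sub>R One) \<subseteq> cbox a b"
  shows "((\<lambda>\<epsilon>. mollified a b u \<epsilon> x) \<longlongrightarrow> bump_mass TYPE(real ^ 'n) *\<^sub>R u x) (at_right 0)"
proof (rule tendstoI)
  fix e :: real assume "0 < e"
  let ?m = "bump_mass TYPE(real ^ 'n)"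
  \<comment> \<open>The kernel has mass ?m, so an oscillation of at most e' costs e' * ?m = e /
    2.\<close>
  define e' where "e' = e / (2 * ?m)"
  have "0 < e'" "e' * ?m < e"
    using \<open>0 < e\<close> bump_mass_pos[where 'a = "real ^ 'n"] by (auto simp: e'_def)
  have "x \<in> cbox (x - R *\<^sub>R One) (x + R *\<^sub>R One)"
    using \<open>0 < R\<close> by (simp add: mem_box algebra_simps)
  then have "x \<in> cbox a b" using sub by blast
  then obtain \<delta> where "\<delta> > 0" and \<delta>: "\<And>y. y \<in> cbox a b \<Longrightarrow> dist y x < \<delta> \<Longrightarrow> dist (u y) (u x) < e'"
    using u \<open>0 < e'\<close> unfolding continuous_on_iff by metis
  have "dist (mollified a b u \<epsilon> x) (?m *\<^sub>R u x) < e" if \<epsilon>: "0 < \<epsilon>" "\<epsilon> < min R \<delta>" for \<epsilon>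
  proof -
    define K where "K = (\<lambda>y. 1 / \<epsilon> ^ CARD('n) * cutoff 0 (1 / \<epsilon>\<^sup>2 * ((y - x) \<bullet> (y - x))))"
    have "cbox (x - \<epsilon> *\<^sub>R One) (x + \<epsilon> *\<^sub>R One) \<subseteq> cbox (x - R *\<^sub>R One) (x + R *\<^sub>R One)"
      using \<epsilon> by (intro subset_box_imp) (auto simp: algebra_simps)
    then have K: "(K has_integral ?m) (cbox a b)"
      using scaled_cutoff_has_integral[of \<epsilon> x a b] \<epsilon> sub unfolding K_def by auto
    have "continuous_on (cbox a b) K" unfolding K_def by (intro continuous_intros)
    then have cont: "continuous_on (cbox a b) (\<lambda>y. K y *\<^sub>R (u y - u x))"
      "(\<lambda>y. K y *\<^sub>R u y) integrable_on cbox a b"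
      using u by (auto intro!: continuous_intros integrable_continuous)
    have m: "((\<lambda>y. K y *\<^sub>R u x) has_integral ?m *\<^sub>R u x) (cbox a b)"
      using K by (rule has_integral_scaleR_left)
    have "mollified a b u \<epsilon> x - ?m *\<^sub>R u x = integral (cbox a b) (\<lambda>y. K y *\<^sub>R u y) - integral (cbox a b) (\<lambda>y. K y *\<^sub>R u x)"
      using m by (simp add: mollified_def K_def integral_unique)
    also have "\<dots> = integral (cbox a b) (\<lambda>y. K y *\<^sub>R (u y - u x))"
      using cont m by (subst Henstock_Kurzweil_Integration.integral_diff[symmetric]) (auto simp: scaleR_diff_right)
    finally have "norm (mollified a b u \<epsilon> x - ?m *\<^sub>R u x) \<le> integral (cbox a b) (\<lambda>y. e' * K y)"
    proof (simp only:, intro integral_norm_bound_integral)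
      fix y assume y: "y \<in> cbox a b"
      have "K y \<ge> 0" using \<epsilon> cutoff_0_nonneg by (simp add: K_def)
      show "norm (K y *\<^sub>R (u y - u x)) \<le> e' * K y"
      proof (cases "y \<in> ball x \<epsilon>")
        case True
        then have "norm (u y - u x) \<le> e'"
          using \<delta>[OF y] \<epsilon> by (simp add: dist_norm norm_minus_commute)
        then have "norm (u y - u x) * K y \<le> e' * K y" using \<open>K y \<ge> 0\<close> by (rule mult_right_mono)
        then show ?thesis using \<open>K y \<ge> 0\<close> by (simp add: mult.commute)
      next
        case False
        then show ?thesis using cutoff_support[OF \<epsilon>(1) False] by (simp add: K_def)
      qed
    next
      show "(\<lambda>y. K y *\<^sub>R (u y - u x)) integrable_on cbox a b"
        using cont(1) by (rule integrable_continuous)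
      show "(\<lambda>y. e' * K y) integrable_on cbox a b"
        using has_integral_mult_right[OF K] by blast
    qed
    also have "\<dots> = e' * ?m" using has_integral_mult_right[OF K] by (rule integral_unique)
    finally show ?thesis using \<open>e' * ?m < e\<close> by (simp add: dist_norm)
  qed
  then show "\<forall>\<^sub>F \<epsilon> in at_right 0. dist (mollified a b u \<epsilon> x) (?m *\<^sub>R u x) < e"
    unfolding eventually_at_right_field using \<open>0 < R\<close> \<open>0 < \<delta>\<close> by (intro exI[of _ "min R \<delta>"]) auto
qed

section \<open>Gradient bounds uniform in the scale, and passage to the limit\<close>

text \<open>The mean value inequality in the scale. The weak equation replaces the Laplacian of the
  bump by \<open>\<kappa>\<close> times the bump, and no negative power of the scale survives, so
  the estimate does not degenerate near 0.\<close>

lemma mollified_deriv_lipschitz: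
  fixes u :: "real ^ 'n \<Rightarrow> complex"
  assumes u: "continuous_on (cbox a b) u" and M: "\<And>y. y \<in> cbox a b \<Longrightarrow> norm (u y) \<le> M"
    and sub: "cball x R \<subseteq> cbox a b"
    and weak: "\<And>\<phi>. test_function \<phi> \<Longrightarrow> {y. \<phi> y \<noteq> 0} \<subseteq> cball x R \<Longrightarrow>
      (LINT y|lebesgue. (\<Sum>i\<in>UNIV. partial_deriv i (partial_deriv i \<phi>) y) *\<^sub>R u y)
        = \<kappa> * (LINT y|lebesgue. \<phi> y *\<^sub>R u y)"
    and \<epsilon>: "\<epsilon> \<in> {0<..R}" and \<delta>: "\<delta> \<in> {0<..R}"
  shows "norm (mollified_deriv a b u \<epsilon> x h - mollified_deriv a b u \<delta> x h)
    \<le> norm \<kappa> * M * unit_ball_vol (real CARD('n)) * norm h * norm (\<epsilon> - \<delta>)"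
proof -
  define V where "V = (\<lambda>\<epsilon>. (1 / \<epsilon> ^ (CARD('n) + 1)) *\<^sub>R integral (cbox a b) (\<lambda>y. (\<Sum>i\<in>UNIV.
       partial_deriv i (partial_deriv i (directional_bump (1 / \<epsilon>\<^sup>2) x h)) y) *\<^sub>R u y))"
  define C where "C = norm \<kappa> * M * unit_ball_vol (real CARD('n)) * norm h"
  have V: "norm (V \<epsilon>) \<le> C" if "\<epsilon> \<in> {0<..R}" for \<epsilon>
  proof -
    have \<epsilon>: "0 < \<epsilon>" "\<epsilon> \<le> R" using that by auto
    then have ball: "cball x \<epsilon> \<subseteq> cball x R" by auto
    let ?\<psi> = "directional_bump (1 / \<epsilon>\<^sup>2) x h"
    have "x \<in> cbox a b" using sub \<epsilon> by (meson centre_in_cball less_imp_le order_trans subsetD)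
    then have "0 \<le> M" using M norm_ge_zero order_trans by blast
    have t: "test_function ?\<psi>" using \<epsilon>(1) by (rule test_function_directional_bump)
    have s0: "closure {y. ?\<psi> y \<noteq> 0} \<subseteq> cball x \<epsilon>" using \<epsilon>(1) by (rule directional_bump_support)
    have s1: "closure {y. partial_deriv i ?\<psi> y \<noteq> 0} \<subseteq> cball x \<epsilon>" for i
      using support_partial_deriv s0 by (intro closure_minimal) (blast, simp)
    have s2: "partial_deriv i (partial_deriv i ?\<psi>) y = 0" if "y \<notin> cball x \<epsilon>" for i y
      using support_partial_deriv s1 that by blast
    have "integral (cbox a b) (\<lambda>y. (\<Sum>i\<in>UNIV. partial_deriv i (partial_deriv i ?\<psi>) y) *\<^sub>R u y)
        = (LINT y|lebesgue. (\<Sum>i\<in>UNIV. partial_deriv i (partial_deriv i ?\<psi>) y) *\<^sub>R u y)"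
    proof (rule lebesgue_integral_eq_integral_cbox[symmetric])
      show "continuous_on (cbox a b) (\<lambda>y. (\<Sum>i\<in>UNIV. partial_deriv i (partial_deriv i ?\<psi>) y) *\<^sub>R u y)"
        by (intro continuous_intros u test_function_continuous test_function_partial_deriv t)
      show "(\<Sum>i\<in>UNIV. partial_deriv i (partial_deriv i ?\<psi>) y) *\<^sub>R u y = 0" if "y \<notin> cbox a b" for y
      proof -
        have y: "y \<notin> cball x \<epsilon>" using that ball sub by blast
        show ?thesis by (simp only: s2[OF y] sum.neutral_const scaleR_zero_left)
      qed
    qed
    also have "\<dots> = \<kappa> * (LINT y|lebesgue. ?\<psi> y *\<^sub>R u y)"
      using t s0 ball closure_subset[of "{y. ?\<psi> y \<noteq> 0}"] by (intro weak) auto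
    also have "(LINT y|lebesgue. ?\<psi> y *\<^sub>R u y) = (LINT y:ball x \<epsilon>|lebesgue. ?\<psi> y *\<^sub>R u y)"
      unfolding set_lebesgue_integral_def
      by (intro Bochner_Integration.integral_cong refl)
         (use cutoff_support[OF \<epsilon>(1), of _ x] in \<open>auto simp: directional_bump_def indicator_def\<close>)
    finally have eq: "norm (V \<epsilon>) = 1 / \<epsilon> ^ (CARD('n) + 1) * (norm \<kappa> * norm (LINT y:ball x \<epsilon>|lebesgue. ?\<psi> y *\<^sub>R u y))"
      using \<epsilon> by (simp add: V_def norm_mult)
    have bd: "norm (LINT y:ball x \<epsilon>|lebesgue. ?\<psi> y *\<^sub>R u y) \<le> (norm h * \<epsilon> * M) * measure lebesgue (ball x \<epsilon>)"
    proof (rule norm_set_integral_le)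
      show "emeasure lebesgue (ball x \<epsilon>) < \<infinity>" using \<epsilon> by (simp add: emeasure_ball)
      show "0 \<le> norm h * \<epsilon> * M" using \<epsilon> \<open>0 \<le> M\<close> by simp
      fix y assume y: "y \<in> ball x \<epsilon>"
      then have "norm (y - x) \<le> \<epsilon>" by (simp add: dist_norm norm_minus_commute)
      then have "\<bar>h \<bullet> (y - x)\<bar> \<le> norm h * \<epsilon>"
        using Cauchy_Schwarz_ineq2[of h "y - x"] by (meson mult_left_mono norm_ge_zero order_trans)
      then have "\<bar>?\<psi> y\<bar> \<le> norm h * \<epsilon> * 1"
        unfolding directional_bump_def abs_mult using cutoff_0_nonneg cutoff_0_le_1 by (intro mult_mono) auto
      moreover have "y \<in> cball x \<epsilon>" using y by simp
      then have "norm (u y) \<le> M" using ball sub by (intro M) blast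
      ultimately show "norm (?\<psi> y *\<^sub>R u y) \<le> norm h * \<epsilon> * M"
        using \<epsilon> by (simp add: mult_mono)
    qed simp
    have "norm (V \<epsilon>) \<le> 1 / \<epsilon> ^ (CARD('n) + 1) * (norm \<kappa> * ((norm h * \<epsilon> * M) * measure lebesgue (ball x \<epsilon>)))"
      unfolding eq using \<epsilon> by (intro mult_left_mono bd) auto
    \<comment> \<open>The ball contributes the n-th power of the radius and the bump one more, which
      cancels the prefactor exactly.\<close>
    also have "\<dots> = C"
      using \<epsilon> by (simp add: C_def content_ball)
    finally show "norm (V \<epsilon>) \<le> C" .
  qed
  have "norm (mollified_deriv a b u \<epsilon> x h - mollified_deriv a b u \<delta> x h) \<le> C * norm (\<epsilon> - \<delta>)"
  proof (rule differentiable_bound[where S = "{0<..R}" and f' = "\<lambda>\<epsilon> t. t *\<^sub>R V \<epsilon>"])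
    fix \<epsilon> assume \<epsilon>: "\<epsilon> \<in> {0<..R}"
    then have "((\<lambda>\<epsilon>. mollified_deriv a b u \<epsilon> x h) has_vector_derivative V \<epsilon>) (at \<epsilon> within {0<..})"
      unfolding V_def by (intro mollified_deriv_scale_derivative u) auto
    then show "((\<lambda>\<epsilon>. mollified_deriv a b u \<epsilon> x h) has_derivative (\<lambda>t. t *\<^sub>R V \<epsilon>)) (at \<epsilon> within {0<..R})"
      unfolding has_vector_derivative_def by (rule has_derivative_subset) auto
    show "onorm (\<lambda>t. t *\<^sub>R V \<epsilon>) \<le> C"
    proof (rule onorm_le)
      show "norm (t *\<^sub>R V \<epsilon>) \<le> C * norm t" for t
        using mult_right_mono[OF V[OF \<epsilon>], of "\<bar>t\<bar>"] by (simp add: mult.commute)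
    qed
  qed (use \<epsilon> \<delta> in auto)
  then show ?thesis by (simp add: C_def)
qed

text \<open>Needed at one fixed scale only, but uniformly in x, to anchor the bound on the limiting
  gradient. By Cauchy-Schwarz, h . (y - x) may be replaced by |h| |y - x|; what remains is
  continuous in (x, y) on a compact set.\<close>

lemma mollified_deriv_bound:
  fixes u :: "real ^ 'n \<Rightarrow> complex"
  assumes u: "continuous_on (cbox a b) u" and "0 < \<epsilon>"
  shows "\<exists>B. \<forall>x\<in>cbox a b. \<forall>h. norm (mollified_deriv a b u \<epsilon> x h) \<le> B * norm h"
proof -
  define c where "c = (\<lambda>z::(real ^ 'n) \<times> (real ^ 'n).
    (- 2 / \<epsilon> ^ (CARD('n) + 2) * cutoff 1 (1 / \<epsilon>\<^sup>2 * ((snd z - fst z) \<bullet> (snd z - fst z))) * norm (snd z - fst z)) *\<^sub>R u (snd z))"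
  have "continuous_on (cbox a b \<times> cbox a b) c"
    unfolding c_def by (intro continuous_intros continuous_on_compose2[OF u]) auto
  then have "compact (c ` (cbox a b \<times> cbox a b))"
    by (intro compact_continuous_image compact_Times compact_cbox)
  then obtain B where B: "B > 0" "\<And>z. z \<in> cbox a b \<times> cbox a b \<Longrightarrow> norm (c z) \<le> B"
    by (force dest: compact_imp_bounded simp: bounded_pos)
  have "norm (mollified_deriv a b u \<epsilon> x h) \<le> (B * norm h) * measure lborel (cbox a b)" if "x \<in> cbox a b" for x h
  proof -
    define f where "f = (\<lambda>y. (- 2 / \<epsilon> ^ (CARD('n) + 2) * (h \<bullet> (y - x)) * cutoff 1 (1 / \<epsilon>\<^sup>2 * ((y - x) \<bullet> (y - x)))) *\<^sub>R u y)"
    have "f integrable_on cbox a b"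
      unfolding f_def by (intro integrable_continuous continuous_intros u)
    then have "(f has_integral mollified_deriv a b u \<epsilon> x h) (cbox a b)"
      by (simp add: mollified_deriv_def f_def has_integral_integral)
    then show ?thesis
    proof (rule has_integral_bound[rotated])
      show "0 \<le> B * norm h" using B by simp
      fix y assume "y \<in> cbox a b"
      then have "norm (c (x, y)) \<le> B" using B that by blast
      have "norm (f y) \<le> norm h * norm (c (x, y))"
      proof -
        let ?A = "\<bar>2 / \<epsilon> ^ (CARD('n) + 2)\<bar> * \<bar>cutoff 1 (1 / \<epsilon>\<^sup>2 * ((y - x) \<bullet> (y - x)))\<bar> * norm (u y)"
        have "norm (f y) = \<bar>h \<bullet> (y - x)\<bar> * ?A" by (simp add: f_def abs_mult mult_ac)
        also have "\<dots> \<le> (norm h * norm (y - x)) * ?A"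
          by (intro mult_right_mono Cauchy_Schwarz_ineq2) auto
        also have "\<dots> = norm h * norm (c (x, y))" by (simp add: c_def abs_mult mult_ac)
        finally show ?thesis .
      qed
      also have "\<dots> \<le> norm h * B" using \<open>norm (c (x, y)) \<le> B\<close> by (rule mult_left_mono) simp
      finally show "norm (f y) \<le> B * norm h" by (simp add: mult.commute)
    qed
  qed
  then show ?thesis by (intro exI[of _ "B * measure lborel (cbox a b)"]) (simp add: mult_ac)
qed

lemma weak_helmholtz_locally_C1:
  fixes u :: "real ^ 'n \<Rightarrow> complex"
  assumes "open U" "continuous_on U u" "x0 \<in> U"
    and weak: "\<And>\<phi>. test_function \<phi> \<Longrightarrow> {y. \<phi> y \<noteq> 0} \<subseteq> U \<Longrightarrow>
      (LINT y|lebesgue. (\<Sum>i\<in>UNIV. partial_deriv i (partial_deriv i \<phi>) y) *\<^sub>R u y)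
        = \<kappa> * (LINT y|lebesgue. \<phi> y *\<^sub>R u y)"
  shows "\<exists>r>0. \<exists>B u'. \<forall>x\<in>ball x0 r. (u has_derivative u' x) (at x) \<and> (\<forall>h. norm (u' x h) \<le> B * norm h)"
proof -
  let ?m = "bump_mass TYPE(real ^ 'n)"
  obtain \<rho> where "\<rho> > 0" and \<rho>: "cball x0 \<rho> \<subseteq> U"
    using assms open_contains_cball by blast
  \<comment> \<open>A box of half-side 2 R has points at l1-distance at most 2 R n =
    \<open>\<rho>\<close> from its centre, hence lies in the closed ball of radius
    \<open>\<rho>\<close>.\<close>
  define R where "R = \<rho> / (2 * real CARD('n))"
  have "R > 0" using \<open>\<rho> > 0\<close> by (simp add: R_def)
  define a b where "a = x0 - (2 * R) *\<^sub>R One" and "b = x0 + (2 * R) *\<^sub>R One"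
  have in_box: "y \<in> cbox a b \<longleftrightarrow> (\<forall>i\<in>Basis. \<bar>(y - x0) \<bullet> i\<bar> \<le> 2 * R)" for y
    by (force simp: a_def b_def mem_box inner_diff_left inner_add_left abs_le_iff)
  have "cbox a b \<subseteq> cball x0 \<rho>"
  proof
    fix y assume "y \<in> cbox a b"
    then have "norm (y - x0) \<le> (\<Sum>i\<in>(Basis :: (real ^ 'n) set). 2 * R)"
      using in_box by (intro order_trans[OF norm_le_l1] sum_mono) auto
    also have "\<dots> = \<rho>" by (simp add: R_def)
    finally show "y \<in> cball x0 \<rho>" by (simp add: dist_norm norm_minus_commute)
  qed
  then have QU: "cbox a b \<subseteq> U" using \<rho> by blast
  then have u: "continuous_on (cbox a b) u" using assms(2) continuous_on_subset by blast
  then have "compact (u ` cbox a b)" by (intro compact_continuous_image compact_cbox)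
  then obtain M where M: "\<And>y. y \<in> cbox a b \<Longrightarrow> norm (u y) \<le> M"
    by (force dest: compact_imp_bounded simp: bounded_iff)
  \<comment> \<open>Half the size of the box: balls and cubes of radius R about points of
    \<open>S\<close> remain inside it, so every scale up to R is admissible.\<close>
  define S where "S = ball x0 R"
  have S: "cball x R \<subseteq> cbox a b" "cbox (x - R *\<^sub>R One) (x + R *\<^sub>R One) \<subseteq> cbox a b" "x \<in> cbox a b"
    if "x \<in> S" for x
  proof -
    have x: "\<bar>(x - x0) \<bullet> i\<bar> \<le> R" if "i \<in> Basis" for i
      using Basis_le_norm[OF that, of "x - x0"] \<open>x \<in> S\<close> by (simp add: S_def dist_norm norm_minus_commute)
    have *: "y \<in> cbox a b" if "\<And>i. i \<in> Basis \<Longrightarrow> \<bar>(y - x) \<bullet> i\<bar> \<le> R" for y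
      unfolding in_box
    proof
      fix i :: "real ^ 'n" assume "i \<in> Basis"
      then show "\<bar>(y - x0) \<bullet> i\<bar> \<le> 2 * R"
        using that[of i] x[of i] by (simp add: inner_diff_left)
    qed
    show "cball x R \<subseteq> cbox a b"
    proof
      fix y assume "y \<in> cball x R"
      then show "y \<in> cbox a b"
        using Basis_le_norm[of _ "y - x"] by (intro *) (force simp: dist_norm norm_minus_commute)
    qed
    show "cbox (x - R *\<^sub>R One) (x + R *\<^sub>R One) \<subseteq> cbox a b"
    proof
      fix y assume "y \<in> cbox (x - R *\<^sub>R One) (x + R *\<^sub>R One)"
      then show "y \<in> cbox a b"
        by (intro *) (force simp: mem_box inner_diff_left inner_add_left abs_le_iff)
    qed
    show "x \<in> cbox a b" using \<open>R > 0\<close> by (intro *) auto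
  qed
  define C where "C = norm \<kappa> * M * unit_ball_vol (real CARD('n))"
  have "x0 \<in> S" using \<open>R > 0\<close> by (simp add: S_def)
  then have "0 \<le> M" using M[OF S(3)] norm_ge_zero order_trans by blast
  then have "0 \<le> C" by (simp add: C_def)
  define G where "G = mollified_deriv a b u"
  have lip: "norm (G \<epsilon> x h - G \<delta> x h) \<le> C * norm h * \<bar>\<epsilon> - \<delta>\<bar>"
    if "x \<in> S" "\<epsilon> \<in> {0<..R}" "\<delta> \<in> {0<..R}" for \<epsilon> \<delta> x h
    using mollified_deriv_lipschitz[OF u M S(1)[OF that(1)] _ that(2,3), of \<kappa> h] weak S(1)[OF that(1)] QU
    unfolding C_def G_def by auto
  \<comment> \<open>The sequence starts at \<open>\<epsilon> 0 = R\<close>, the scale at which the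
    fixed bound is used below.\<close>
  define \<epsilon> where "\<epsilon> = (\<lambda>j::nat. R / (real j + 1))"
  have \<epsilon>: "\<epsilon> j \<in> {0<..R}" for j using \<open>R > 0\<close> by (simp add: \<epsilon>_def field_simps)
  have \<epsilon>0: "\<epsilon> \<longlonglongrightarrow> 0" unfolding \<epsilon>_def by real_asymp
  have \<epsilon>_right: "filterlim \<epsilon> (at_right 0) sequentially"
    unfolding filterlim_at using \<epsilon>0 \<epsilon> by (auto simp: greaterThanAtMost_iff less_imp_neq[THEN not_sym])
  have "\<exists>l. (\<lambda>j. G (\<epsilon> j) x h) \<longlonglongrightarrow> l" if "x \<in> S" for x h
  proof -
    have "Cauchy (\<lambda>j. G (\<epsilon> j) x h)"
    proof (rule CauchyI)
      fix e :: real assume "0 < e"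
      define K where "K = C * norm h + 1"
      have "K > 0" "C * norm h \<le> K" using \<open>0 \<le> C\<close> by (auto simp: K_def add_nonneg_pos)
      have "Cauchy \<epsilon>" using \<epsilon>0 by (rule LIMSEQ_imp_Cauchy)
      then obtain N where N: "\<And>i j. i \<ge> N \<Longrightarrow> j \<ge> N \<Longrightarrow> norm (\<epsilon> i - \<epsilon> j) < e / K"
        using \<open>0 < e\<close> \<open>K > 0\<close> CauchyD[of \<epsilon> "e / K"] by auto
      have "norm (G (\<epsilon> i) x h - G (\<epsilon> j) x h) < e" if "i \<ge> N" "j \<ge> N" for i j
      proof -
        have "norm (G (\<epsilon> i) x h - G (\<epsilon> j) x h) \<le> C * norm h * \<bar>\<epsilon> i - \<epsilon> j\<bar>"
          using \<open>x \<in> S\<close> \<epsilon> by (intro lip)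
        also have "\<dots> \<le> K * \<bar>\<epsilon> i - \<epsilon> j\<bar>" using \<open>C * norm h \<le> K\<close> by (intro mult_right_mono) auto
        also have "\<dots> < e" using N[OF that] \<open>K > 0\<close> by (simp add: field_simps)
        finally show ?thesis .
      qed
      then show "\<exists>N. \<forall>i\<ge>N. \<forall>j\<ge>N. norm (G (\<epsilon> i) x h - G (\<epsilon> j) x h) < e" by blast
    qed
    then show ?thesis by (simp add: Cauchy_convergent_iff convergent_def)
  qed
  then obtain g' where g': "\<And>x h. x \<in> S \<Longrightarrow> (\<lambda>j. G (\<epsilon> j) x h) \<longlonglongrightarrow> g' x h"
    by metis
  \<comment> \<open>Letting the second scale tend to 0 in \<open>lip\<close> gives a rate that is
    uniform in x and linear in h.\<close>
  have close: "norm (G (\<epsilon> j) x h - g' x h) \<le> C * norm h * \<epsilon> j" if "x \<in> S" for j x h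
  proof (rule tendsto_le[OF trivial_limit_sequentially])
    show "(\<lambda>i. C * norm h * \<bar>\<epsilon> j - \<epsilon> i\<bar>) \<longlonglongrightarrow> C * norm h * \<epsilon> j"
    proof -
      have "(\<lambda>i. C * norm h * \<bar>\<epsilon> j - \<epsilon> i\<bar>) \<longlonglongrightarrow> C * norm h * \<bar>\<epsilon> j - 0\<bar>"
        by (intro tendsto_intros \<epsilon>0)
      then show ?thesis using \<epsilon>[of j] by simp
    qed
    show "(\<lambda>i. norm (G (\<epsilon> j) x h - G (\<epsilon> i) x h)) \<longlonglongrightarrow> norm (G (\<epsilon> j) x h - g' x h)"
      by (intro tendsto_intros g' that)
    show "\<forall>\<^sub>F i in sequentially. norm (G (\<epsilon> j) x h - G (\<epsilon> i) x h) \<le> C * norm h * \<bar>\<epsilon> j - \<epsilon> i\<bar>"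
      using lip[OF that \<epsilon> \<epsilon>] by simp
  qed
  have lim: "(\<lambda>j. mollified a b u (\<epsilon> j) x) \<longlonglongrightarrow> ?m *\<^sub>R u x" if "x \<in> S" for x
    using filterlim_compose[OF mollified_tendsto[OF u \<open>R > 0\<close> S(2)[OF that]] \<epsilon>_right] .
  have "\<exists>g. \<forall>x\<in>S. (\<lambda>j. mollified a b u (\<epsilon> j) x) \<longlonglongrightarrow> g x \<and> (g has_derivative g' x) (at x within S)"
  proof (rule has_derivative_sequence[where f' = "\<lambda>j. G (\<epsilon> j)" and S = S and ?x0.0 = x0])
    show "x0 \<in> S" by fact
    show "(\<lambda>j. mollified a b u (\<epsilon> j) x0) \<longlonglongrightarrow> ?m *\<^sub>R u x0" by (rule lim) fact
    show "convex S" by (simp add: S_def)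
    show "(mollified a b u (\<epsilon> j) has_derivative G (\<epsilon> j) x) (at x within S)" if "x \<in> S" for j x
      unfolding G_def using \<epsilon>[of j] that by (intro mollified_has_derivative u) (auto simp: S_def)
    fix e :: real assume "0 < e"
    have "(\<lambda>j. C * \<epsilon> j) \<longlonglongrightarrow> C * 0" by (intro tendsto_intros \<epsilon>0)
    then have "\<forall>\<^sub>F j in sequentially. C * \<epsilon> j < e" using \<open>0 < e\<close> by (intro order_tendstoD) auto
    then show "\<forall>\<^sub>F j in sequentially. \<forall>x\<in>S. \<forall>h. norm (G (\<epsilon> j) x h - g' x h) \<le> e * norm h"
    proof eventually_elim
      case (elim j)
      have "C * norm h * \<epsilon> j \<le> e * norm h" for h :: "real ^ 'n"
        using mult_right_mono[OF less_imp_le[OF elim], of "norm h"] by (simp add: mult_ac)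
      then show ?case using close order_trans by blast
    qed
  qed
  then obtain g where g: "\<And>x. x \<in> S \<Longrightarrow> (\<lambda>j. mollified a b u (\<epsilon> j) x) \<longlonglongrightarrow> g x"
    "\<And>x. x \<in> S \<Longrightarrow> (g has_derivative g' x) (at x within S)" by blast
  have g_eq: "g x = ?m *\<^sub>R u x" if "x \<in> S" for x
    using LIMSEQ_unique[OF g(1) lim] that by blast
  have du: "(u has_derivative (\<lambda>h. (1 / ?m) *\<^sub>R g' x h)) (at x)" if "x \<in> S" for x
  proof -
    have "(g has_derivative g' x) (at x)"
      using g(2)[OF that] that by (simp add: S_def at_within_open[OF _ open_ball])
    then have "((\<lambda>y. (1 / ?m) *\<^sub>R g y) has_derivative (\<lambda>h. (1 / ?m) *\<^sub>R g' x h)) (at x)"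
      by (rule has_derivative_scaleR_right)
    then show ?thesis
      by (rule has_derivative_transform_within_open[where s = S])
         (use that bump_mass_pos[where 'a = "real ^ 'n"] g_eq in \<open>auto simp: S_def\<close>)
  qed
  obtain B where B: "\<And>x h. x \<in> cbox a b \<Longrightarrow> norm (G R x h) \<le> B * norm h"
    using mollified_deriv_bound[OF u \<open>R > 0\<close>] unfolding G_def by blast
  have "norm ((1 / ?m) *\<^sub>R g' x h) \<le> (1 / ?m * (B + C * R)) * norm h" if "x \<in> S" for x h
  proof -
    \<comment> \<open>Compare with the gradient at scale R, which \<open>B\<close> controls; the
      distance to the limit is \<open>close\<close> at index 0.\<close>
    have "norm (g' x h) \<le> norm (G R x h) + norm (G R x h - g' x h)"
      by (metis add.commute diff_add_cancel norm_minus_commute norm_triangle_ineq)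
    also have "\<dots> \<le> B * norm h + C * norm h * R"
      using B[OF S(3)[OF that]] close[OF that, of 0 h] by (intro add_mono) (auto simp: \<epsilon>_def)
    finally show ?thesis
      using bump_mass_pos[where 'a = "real ^ 'n"] by (simp add: field_simps)
  qed
  with du show ?thesis
    using \<open>R > 0\<close> unfolding S_def by (intro exI[of _ R] conjI exI[of _ "1 / ?m * (B + C * R)"]
        exI[of _ "\<lambda>x h. (1 / ?m) *\<^sub>R g' x h"]) auto
qed

section \<open>Transfer to the scattered field\<close>

lemma incident_field_has_derivative:
  "(incident_field k d has_derivative (\<lambda>h. incident_field k d x * (\<i> * of_real (k * (h \<bullet> d))))) (at x)"
proof -
  have "((\<lambda>x. \<i> * of_real (k * (x \<bullet> d))) has_derivative (\<lambda>h. \<i> * of_real (k * (h \<bullet> d)))) (at x)"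
    by (auto intro!: derivative_eq_intros)
  then show ?thesis
    unfolding incident_field_def[abs_def]
    by (rule has_derivative_compose[OF _ has_field_derivative_imp_has_derivative[OF DERIV_exp]])
qed

text \<open>The weak equation is stated for the total field, so regularity is proved there with
  \<open>\<kappa>\<close> = -k^2. Subtracting the plane wave, whose gradient has size at most |k|,
  keeps the bound.\<close>

lemma scattered_field_locally_C1:
  fixes u\<^sub>s\<^sub>c :: "real ^ 'n \<Rightarrow> complex"
  assumes sc: "scattered_field k d D \<eta> u\<^sub>s\<^sub>c" and "norm d = 1"
    and \<eta>: "\<And>x. x \<notin> closure D \<Longrightarrow> \<eta> x = 0" and x0: "x0 \<notin> closure D"
  shows "\<exists>r>0. \<exists>B. \<forall>x\<in>ball x0 r. \<forall>h. norm (frechet_derivative u\<^sub>s\<^sub>c (at x) h) \<le> B * norm h"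
proof -
  define u where "u = (\<lambda>x. u\<^sub>s\<^sub>c x + incident_field k d x)"
  have u: "weak_helmholtz_solution k \<eta> u" and cont: "continuous_on (- closure D) u\<^sub>s\<^sub>c"
    using sc unfolding scattered_field_def u_def by blast+
  have "\<exists>r>0. \<exists>B u'. \<forall>x\<in>ball x0 r. (u has_derivative u' x) (at x) \<and> (\<forall>h. norm (u' x h) \<le> B * norm h)"
  proof (rule weak_helmholtz_locally_C1)
    show "open (- closure D)" "x0 \<in> - closure D" using x0 by auto
    have "continuous_on (- closure D) (incident_field k d)"
      using has_derivative_continuous[OF incident_field_has_derivative]
      by (auto intro: continuous_at_imp_continuous_on)
    then show "continuous_on (- closure D) u"
      unfolding u_def using cont by (intro continuous_on_add)
    fix \<phi> :: "real ^ 'n \<Rightarrow> real"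
    assume "test_function \<phi>" "{y. \<phi> y \<noteq> 0} \<subseteq> - closure D"
    then show "(LINT y|lebesgue. (\<Sum>i\<in>UNIV. partial_deriv i (partial_deriv i \<phi>) y) *\<^sub>R u y)
        = - of_real (k\<^sup>2) * (LINT y|lebesgue. \<phi> y *\<^sub>R u y)"
      using \<eta> by (intro weak_helmholtz_solution_distributional[OF u]) blast+
  qed
  then obtain r B u' where "r > 0" and u': "\<And>x. x \<in> ball x0 r \<Longrightarrow> (u has_derivative u' x) (at x)"
    "\<And>x h. x \<in> ball x0 r \<Longrightarrow> norm (u' x h) \<le> B * norm h" by blast
  have "norm (frechet_derivative u\<^sub>s\<^sub>c (at x) h) \<le> (B + \<bar>k\<bar>) * norm h" if "x \<in> ball x0 r" for x h
  proof -
    have "((\<lambda>x. u x - incident_field k d x) has_derivative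
        (\<lambda>h. u' x h - incident_field k d x * (\<i> * of_real (k * (h \<bullet> d))))) (at x)"
      by (intro has_derivative_diff u' that incident_field_has_derivative)
    then have "(u\<^sub>s\<^sub>c has_derivative (\<lambda>h. u' x h - incident_field k d x * (\<i> * of_real (k * (h \<bullet> d))))) (at x)"
      by (simp add: u_def)
    from frechet_derivative_at[OF this]
    have "frechet_derivative u\<^sub>s\<^sub>c (at x) h = u' x h - incident_field k d x * (\<i> * of_real (k * (h \<bullet> d)))"
      by (rule fun_cong[OF sym])
    then have "norm (frechet_derivative u\<^sub>s\<^sub>c (at x) h)
        \<le> norm (u' x h) + norm (incident_field k d x * (\<i> * of_real (k * (h \<bullet> d))))"
      by (simp only: norm_triangle_ineq4)
    moreover have "norm (incident_field k d x * (\<i> * of_real (k * (h \<bullet> d)))) \<le> \<bar>k\<bar> * norm h"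
    proof -
      have "norm (incident_field k d x) = 1" unfolding incident_field_def by (rule norm_exp_i_times)
      then have "norm (incident_field k d x * (\<i> * of_real (k * (h \<bullet> d)))) = \<bar>k\<bar> * \<bar>h \<bullet> d\<bar>"
        by (simp only: norm_mult norm_ii norm_of_real abs_mult mult_1)
      also have "\<dots> \<le> \<bar>k\<bar> * norm h"
        using Cauchy_Schwarz_ineq2[of h d] \<open>norm d = 1\<close> by (intro mult_left_mono) auto
      finally show ?thesis .
    qed
    ultimately have "norm (frechet_derivative u\<^sub>s\<^sub>c (at x) h) \<le> B * norm h + \<bar>k\<bar> * norm h"
      using u'(2)[OF that, of h] by linarith
    then show ?thesis by (simp add: algebra_simps)
  qed
  then show ?thesis using \<open>r > 0\<close> by blast
qed


section \<open>The decay estimate\<close>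

text \<open>An inequality, because of the dummy value 0 at points without a normal.\<close>

lemma norm_outward_normal_le_1: "norm (outward_normal \<Omega> x) \<le> 1"
proof (cases "\<exists>!\<nu>. is_outward_normal \<Omega> x \<nu>")
  case True
  have "norm \<nu> = 1" if "is_outward_normal \<Omega> x \<nu>" for \<nu>
    using that by (simp add: is_outward_normal_def)
  from this[OF theI'[OF True]] True show ?thesis by (simp add: outward_normal_def)
qed (simp add: outward_normal_def)

text \<open>Monotonicity in \<open>B\<close> lets the maximum over a finite subcover serve every
  point.\<close>

lemma locally_bounded_imp_bounded_on_compact:
  fixes K :: "'a::metric_space set" and P :: "real \<Rightarrow> 'a \<Rightarrow> bool"
  assumes "compact K" and mono: "\<And>B B' x. P B x \<Longrightarrow> B \<le> B' \<Longrightarrow> P B' x"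
    and loc: "\<And>x. x \<in> K \<Longrightarrow> \<exists>r>0. \<exists>B. \<forall>y\<in>ball x r. P B y"
  obtains B where "\<And>x. x \<in> K \<Longrightarrow> P B x"
proof -
  obtain r B where r: "\<And>x. x \<in> K \<Longrightarrow> r x > 0" "\<And>x y. x \<in> K \<Longrightarrow> y \<in> ball x (r x) \<Longrightarrow> P (B x) y"
    using loc by metis
  obtain F where F: "F \<subseteq> K" "finite F" "K \<subseteq> (\<Union>x\<in>F. ball x (r x))"
    by (rule compactE_image[OF \<open>compact K\<close>, where C = K and f = "\<lambda>x. ball x (r x)"]) (use r in force)+
  have "P (Max (B ` F)) y" if y: "y \<in> K" for y
  proof -
    obtain x where x: "x \<in> F" "y \<in> ball x (r x)" using F y by blast
    then have "P (B x) y" using F(1) by (intro r(2)) auto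
    moreover have "B x \<le> Max (B ` F)" using F(2) x(1) by simp
    ultimately show ?thesis by (rule mono)
  qed
  then show thesis by (rule that)
qed

theorem mainTheorem3:
  fixes D \<Omega> :: "(real ^ 'n) set"
    and k :: real
    and d :: "real ^ 'n"
    and \<rho> :: nat
    and \<eta> u\<^sub>s\<^sub>c :: "real ^ 'n \<Rightarrow> complex"
  assumes "CARD('n) \<in> {2, 3}"
    and "k > 0"
    and "norm d = 1"
    and "\<rho> \<in> {1, 2}"
    and "bounded_lipschitz_domain D"
    and "\<eta> \<in> borel_measurable lebesgue"
    and "bounded (range \<eta>)"
    and "\<And>x. x \<notin> closure D \<Longrightarrow> \<eta> x = 0"
    and "bounded_lipschitz_domain \<Omega>"
    and "closure D \<subseteq> \<Omega>"
    and "scattered_field k d D \<eta> u\<^sub>s\<^sub>c"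
  shows "(\<lambda>z. indicator_functional \<rho> k \<Omega> u\<^sub>s\<^sub>c z)
    \<in> O[inf (filtercomap (\<lambda>z. infdist z D) at_top) (principal (- D))](
        \<lambda>z. 1 / infdist z D powr (real \<rho> * (real CARD('n) - 1) / 2))"
proof -
  define a where "a = (real CARD('n) - 1) / 2"
  have "a \<ge> 0" using assms(1) by (auto simp: a_def)
  have "open \<Omega>" "bounded \<Omega>" using assms(9) by (auto simp: bounded_lipschitz_domain_def)
  then have K: "compact (frontier \<Omega>)" by (simp add: compact_frontier_bounded)
  \<comment> \<open>The open set \<open>\<Omega>\<close> is disjoint from its frontier and contains
    \<open>closure D\<close>, so the frontier lies in the region of regularity.\<close>
  have off: "x \<notin> closure D" if "x \<in> frontier \<Omega>" for x
    using that assms(10) \<open>open \<Omega>\<close> by (auto simp: frontier_def interior_open)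
  obtain C where "C \<ge> 0" and "\<exists>r0>0. \<forall>x z :: real ^ 'n. r0 \<le> dist x z \<longrightarrow>
      \<bar>im_green k x z\<bar> \<le> C * dist x z powr (- a) \<and>
      (\<forall>h. \<bar>frechet_derivative (\<lambda>y. im_green k y z) (at x) h\<bar> \<le> C * dist x z powr (- a) * norm h)"
    using im_green_decay[where 'n = 'n, OF assms(1,2)] unfolding a_def minus_divide_left by blast
  then obtain r0 where "r0 > 0"
    and C: "\<And>x z :: real ^ 'n. r0 \<le> dist x z \<Longrightarrow> \<bar>im_green k x z\<bar> \<le> C * dist x z powr (- a)"
      "\<And>x z h :: real ^ 'n. r0 \<le> dist x z \<Longrightarrow>
        \<bar>frechet_derivative (\<lambda>y. im_green k y z) (at x) h\<bar> \<le> C * dist x z powr (- a) * norm h"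
    by blast
  have "compact (u\<^sub>s\<^sub>c ` frontier \<Omega>)"
    using assms(11) off by (intro compact_continuous_image K)
      (auto simp: scattered_field_def elim!: continuous_on_subset)
  then obtain A where "A > 0" and A: "\<And>x. x \<in> frontier \<Omega> \<Longrightarrow> norm (u\<^sub>s\<^sub>c x) \<le> A"
    by (force dest: compact_imp_bounded simp: bounded_pos)
  obtain B where B: "\<And>x h. x \<in> frontier \<Omega> \<Longrightarrow> norm (frechet_derivative u\<^sub>s\<^sub>c (at x) h) \<le> B * norm h"
  proof (rule locally_bounded_imp_bounded_on_compact[OF K, where
      P = "\<lambda>B x. \<forall>h. norm (frechet_derivative u\<^sub>s\<^sub>c (at x) h) \<le> B * norm h"])
    show "\<exists>r>0. \<exists>B. \<forall>y\<in>ball x r. \<forall>h. norm (frechet_derivative u\<^sub>s\<^sub>c (at y) h) \<le> B * norm h"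
      if "x \<in> frontier \<Omega>" for x
      using scattered_field_locally_C1[OF assms(11,3,8) off[OF that]] .
  qed (meson mult_right_mono norm_ge_zero order_trans, blast)
  have "compact ((\<lambda>x. infdist x D) ` frontier \<Omega>)"
    by (intro compact_continuous_image K continuous_intros)
  then obtain M where "M > 0" and M: "\<And>x. x \<in> frontier \<Omega> \<Longrightarrow> infdist x D \<le> M"
    by (force dest: compact_imp_bounded simp: bounded_pos)
  \<comment> \<open>Makes the constant nonnegative without inspecting whether \<open>B\<close>
    already is.\<close>
  define B' where "B' = max B 0"
  define c where "c = C * (A + B') * 2 powr a * measure surface_measure (frontier \<Omega>)"
  \<comment> \<open>From infdist z D \<le> M + |x - z| and the threshold 2 (M + r0), |x - z| is at
    least r0 and at least half of infdist z D. The halving is the source of \<open>2 powr a\<close>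
    in \<open>c\<close>.\<close>
  have bound: "norm (LINT x:frontier \<Omega>|surface_measure.
        of_real (frechet_derivative (\<lambda>y. im_green k y z) (at x) (outward_normal \<Omega> x)) * u\<^sub>s\<^sub>c x
        - of_real (im_green k x z) * frechet_derivative u\<^sub>s\<^sub>c (at x) (outward_normal \<Omega> x))
      \<le> c * infdist z D powr (- a)"
    if z: "2 * (M + r0) \<le> infdist z D" for z
  proof -
    define t where "t = C * (2 powr a * infdist z D powr (- a))"
    have "t \<ge> 0" using \<open>C \<ge> 0\<close> by (simp add: t_def)
    have "norm (LINT x:frontier \<Omega>|surface_measure.
        of_real (frechet_derivative (\<lambda>y. im_green k y z) (at x) (outward_normal \<Omega> x)) * u\<^sub>s\<^sub>c x
        - of_real (im_green k x z) * frechet_derivative u\<^sub>s\<^sub>c (at x) (outward_normal \<Omega> x))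
      \<le> (t * (A + B')) * measure surface_measure (frontier \<Omega>)"
    proof (rule norm_set_integral_le)
      show "frontier \<Omega> \<in> sets surface_measure"
        unfolding surface_measure_def using sets.sigma_sets_eq[of borel] by (simp add: sets_measure_of_conv)
      show "emeasure surface_measure (frontier \<Omega>) < \<infinity>"
        by (rule surface_measure_frontier_finite[OF assms(9)])
      show "0 \<le> t * (A + B')" using \<open>t \<ge> 0\<close> \<open>A > 0\<close> by (simp add: B'_def)
      fix x assume x: "x \<in> frontier \<Omega>"
      let ?\<nu> = "outward_normal \<Omega> x"
      have \<nu>: "norm ?\<nu> \<le> 1" by (rule norm_outward_normal_le_1)
      have "infdist z D \<le> infdist x D + dist z x" by (rule infdist_triangle)
      then have half: "infdist z D / 2 \<le> dist x z" and "r0 \<le> dist x z"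
        using M[OF x] z \<open>M > 0\<close> \<open>r0 > 0\<close> by (auto simp: dist_commute)
      have "dist x z powr (- a) \<le> (infdist z D / 2) powr (- a)"
        using half z \<open>M > 0\<close> \<open>r0 > 0\<close> \<open>a \<ge> 0\<close> by (intro powr_mono2') auto
      also have "\<dots> = 2 powr a * infdist z D powr (- a)"
        by (simp add: powr_divide powr_minus_divide)
      finally have t: "C * dist x z powr (- a) \<le> t"
        unfolding t_def using \<open>C \<ge> 0\<close> by (rule mult_left_mono)
      have 1: "\<bar>im_green k x z\<bar> \<le> t" using C(1)[OF \<open>r0 \<le> dist x z\<close>] t by linarith
      have "\<bar>frechet_derivative (\<lambda>y. im_green k y z) (at x) ?\<nu>\<bar> \<le> C * dist x z powr (- a) * norm ?\<nu>"
        by (rule C(2)[OF \<open>r0 \<le> dist x z\<close>])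
      also have "\<dots> \<le> t * 1" using t \<nu> \<open>t \<ge> 0\<close> by (intro mult_mono) auto
      finally have 2: "\<bar>frechet_derivative (\<lambda>y. im_green k y z) (at x) ?\<nu>\<bar> \<le> t" by simp
      have "norm (frechet_derivative u\<^sub>s\<^sub>c (at x) ?\<nu>) \<le> B * norm ?\<nu>" by (rule B[OF x])
      also have "\<dots> \<le> B' * 1" using \<nu> by (intro mult_mono) (auto simp: B'_def)
      finally have 3: "norm (frechet_derivative u\<^sub>s\<^sub>c (at x) ?\<nu>) \<le> B'" by simp
      have "norm (of_real (frechet_derivative (\<lambda>y. im_green k y z) (at x) ?\<nu>) * u\<^sub>s\<^sub>c x
          - of_real (im_green k x z) * frechet_derivative u\<^sub>s\<^sub>c (at x) ?\<nu>) \<le> t * A + t * B'"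
        by (rule order_trans[OF norm_triangle_ineq4])
          (use 1 2 3 A[OF x] \<open>t \<ge> 0\<close> in \<open>auto simp: norm_mult intro!: add_mono mult_mono\<close>)
      then show "norm (of_real (frechet_derivative (\<lambda>y. im_green k y z) (at x) ?\<nu>) * u\<^sub>s\<^sub>c x
          - of_real (im_green k x z) * frechet_derivative u\<^sub>s\<^sub>c (at x) ?\<nu>) \<le> t * (A + B')"
        by (simp add: algebra_simps)
    qed
    also have "\<dots> = c * infdist z D powr (- a)" by (simp add: c_def t_def mult_ac)
    finally show ?thesis .
  qed
  show ?thesis
  proof (rule bigoI)
    have "\<forall>\<^sub>F z in filtercomap (\<lambda>z. infdist z D) at_top. 2 * (M + r0) \<le> infdist z D"
      by (intro eventually_filtercomapI eventually_ge_at_top)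
    then have "\<forall>\<^sub>F z in inf (filtercomap (\<lambda>z. infdist z D) at_top) (principal (- D)).
        2 * (M + r0) \<le> infdist z D"
      by (rule filter_leD[OF inf_le1])
    then show "\<forall>\<^sub>F z in inf (filtercomap (\<lambda>z. infdist z D) at_top) (principal (- D)).
        norm (indicator_functional \<rho> k \<Omega> u\<^sub>s\<^sub>c z) \<le>
        c ^ \<rho> * norm (1 / infdist z D powr (real \<rho> * (real CARD('n) - 1) / 2))"
    proof eventually_elim
      case (elim z)
      then have pos: "infdist z D > 0" using \<open>M > 0\<close> \<open>r0 > 0\<close> by simp
      have eq: "(infdist z D powr (- a)) ^ \<rho> = 1 / infdist z D powr (real \<rho> * (real CARD('n) - 1) / 2)"
      proof -
        have "(infdist z D powr (- a)) ^ \<rho> = infdist z D powr (real \<rho> * - a)"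
          using pos by (intro powr_power) simp
        also have "real \<rho> * - a = - (real \<rho> * (real CARD('n) - 1) / 2)" by (simp add: a_def)
        finally show ?thesis by (simp only: powr_minus_divide)
      qed
      have "norm (indicator_functional \<rho> k \<Omega> u\<^sub>s\<^sub>c z) \<le> (c * infdist z D powr (- a)) ^ \<rho>"
        unfolding indicator_functional_def using bound[OF elim] by (simp add: power_mono)
      also have "(c * infdist z D powr (- a)) ^ \<rho> =
          c ^ \<rho> * norm (1 / infdist z D powr (real \<rho> * (real CARD('n) - 1) / 2))"
        unfolding power_mult_distrib eq by simp
      finally show ?case .
    qed
  qed
qed

end
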